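(* Let $A$ be a $C^*$-algebra and $n\in\mathbb{N}$. Assume that $A$ is approximated by sub-$C^*$-algebras $A_\lambda\subseteq A$ ($\lambda\in\Lambda$) with $\operatorname{gr}(A_\lambda)\le n$ for each $\lambda$. Then $\operatorname{gr}(A)\le n$. Moreover, if $A=\varinjlim_j A_j$ is an inductive limit of $C^*$-algebras, then $\operatorname{gr}(A)\le\liminf_j\operatorname{gr}(A_j)$.
   Context: $\mathbb{N}=\{0,1,2,\dots\}$. For a $C^*$-algebra $A$, $A_{\mathrm{sa}}$ is the set of self-adjoint elements; $C^*(b_0,\dots,b_n)$ is the (not necessarily unital) sub-$C^*$-algebra generated by $b_0,\dots,b_n$; $\widetilde{A}$ is the minimal unitization ($\widetilde A=A$ if $A$ is unital). For $G\subseteq A$, $c\in_\varepsilon G$ means that there is $g\in G$ with $\|c-g\|<\varepsilon$. $\operatorname{gr}_0(A)$ is the smallest integer $n\ge 0$ such that for all $a_0,\dots,a_n\in A_{\mathrm{sa}}$, $\varepsilon>0$ and $c\in A$ there exist $b_0,\dots,b_n\in A_{\mathrm{sa}}$ with $\|b_j-a_j\|<\varepsilon$ for $j=0,\dots,n$ and $c\in_\varepsilon C^*(b_0,\dots,b_n)$; $\operatorname{gr}_0(A)=\infty$ if no such $n$ exists. The generator rank of $A$ is $\operatorname{gr}(A):=\operatorname{gr}_0(\widetilde A)$. A collection $(A_\lambda)_{\lambda\in\Lambda}$ of sub-$C^*$-algebras of $A$ (not required to be directed) approximates $A$ if for every finite subset $F\subseteq A$ and every $\varepsilon>0$ there exists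 $\lambda\in\Lambda$ such that $a\in_\varepsilon A_\lambda$ for every $a\in F$. Inductive limits are over arbitrary directed index sets, with connecting $*$-homomorphisms that need not be injective or unital. *)

theory Defs
  imports "HOL-Analysis.Analysis" "HOL-Algebra.Module" "HOL-Library.Extended_Nat"
begin

definition complex_ring :: "complex ring" where
  "complex_ring = \<lparr>carrier = UNIV, mult = (*), one = 1, zero = 0, add = (+)\<rparr>"

text \<open>C*-algebras need not be unital, so the field \<open>one\<close> inherited from the ring record is
  left unconstrained and never referred to; being unital is the property \<open>unital\<close> below.\<close>

record 'a cstar = "(complex, 'a) module" +
  star :: "'a \<Rightarrow> 'a"
  cnorm :: "'a \<Rightarrow> real"

text \<open>The guard makes this a function to which the locale \<open>Metric_space\<close> applies, as that locale
  requires nonnegativity and symmetry outside the carrier as well.\<close>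

definition cdist :: "('a, 'm) cstar_scheme \<Rightarrow> 'a \<Rightarrow> 'a \<Rightarrow> real" where
  "cdist A x y = (if x \<in> carrier A \<and> y \<in> carrier A then cnorm A (x \<ominus>\<^bsub>A\<^esub> y) else 0)"

abbreviation ctopology :: "('a, 'm) cstar_scheme \<Rightarrow> 'a topology" where
  "ctopology A \<equiv> Metric_space.mtopology (carrier A) (cdist A)"

locale cstar_algebra = Module.module complex_ring A for A (structure) +
  assumes mult_closed: "\<lbrakk>x \<in> carrier A; y \<in> carrier A\<rbrakk> \<Longrightarrow> x \<otimes> y \<in> carrier A"
    and mult_assoc: "\<lbrakk>x \<in> carrier A; y \<in> carrier A; z \<in> carrier A\<rbrakk>
      \<Longrightarrow> (x \<otimes> y) \<otimes> z = x \<otimes> (y \<otimes> z)"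
    and mult_l_distr: "\<lbrakk>x \<in> carrier A; y \<in> carrier A; z \<in> carrier A\<rbrakk>
      \<Longrightarrow> (x \<oplus> y) \<otimes> z = x \<otimes> z \<oplus> y \<otimes> z"
    and mult_r_distr: "\<lbrakk>x \<in> carrier A; y \<in> carrier A; z \<in> carrier A\<rbrakk>
      \<Longrightarrow> z \<otimes> (x \<oplus> y) = z \<otimes> x \<oplus> z \<otimes> y"
    and smult_mult_left: "\<lbrakk>x \<in> carrier A; y \<in> carrier A\<rbrakk> \<Longrightarrow> (\<alpha> \<odot> x) \<otimes> y = \<alpha> \<odot> (x \<otimes> y)"
    and smult_mult_right: "\<lbrakk>x \<in> carrier A; y \<in> carrier A\<rbrakk> \<Longrightarrow> x \<otimes> (\<alpha> \<odot> y) = \<alpha> \<odot> (x \<otimes> y)"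
    and star_closed: "x \<in> carrier A \<Longrightarrow> star A x \<in> carrier A"
    and star_star: "x \<in> carrier A \<Longrightarrow> star A (star A x) = x"
    and star_add: "\<lbrakk>x \<in> carrier A; y \<in> carrier A\<rbrakk> \<Longrightarrow> star A (x \<oplus> y) = star A x \<oplus> star A y"
    and star_smult: "x \<in> carrier A \<Longrightarrow> star A (\<alpha> \<odot> x) = cnj \<alpha> \<odot> star A x"
    and star_mult: "\<lbrakk>x \<in> carrier A; y \<in> carrier A\<rbrakk> \<Longrightarrow> star A (x \<otimes> y) = star A y \<otimes> star A x"
    and norm_nonneg: "x \<in> carrier A \<Longrightarrow> 0 \<le> cnorm A x"
    and norm_eq_zero: "x \<in> carrier A \<Longrightarrow> cnorm A x = 0 \<longleftrightarrow> x = \<zero>"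
    and norm_triangle: "\<lbrakk>x \<in> carrier A; y \<in> carrier A\<rbrakk>
      \<Longrightarrow> cnorm A (x \<oplus> y) \<le> cnorm A x + cnorm A y"
    and norm_smult: "x \<in> carrier A \<Longrightarrow> cnorm A (\<alpha> \<odot> x) = cmod \<alpha> * cnorm A x"
    and norm_mult: "\<lbrakk>x \<in> carrier A; y \<in> carrier A\<rbrakk>
      \<Longrightarrow> cnorm A (x \<otimes> y) \<le> cnorm A x * cnorm A y"
    and cstar_identity: "x \<in> carrier A \<Longrightarrow> cnorm A (star A x \<otimes> x) = (cnorm A x)\<^sup>2"
    and complete: "Metric_space.mcomplete (carrier A) (cdist A)"

definition self_adjoint :: "('a, 'm) cstar_scheme \<Rightarrow> 'a set" where
  "self_adjoint A = {a \<in> carrier A. star A a = a}"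

definition unital :: "('a, 'm) cstar_scheme \<Rightarrow> bool" where
  "unital A \<longleftrightarrow> (\<exists>e\<in>carrier A. \<forall>a\<in>carrier A. e \<otimes>\<^bsub>A\<^esub> a = a \<and> a \<otimes>\<^bsub>A\<^esub> e = a)"

text \<open>The algebra \<open>A \<oplus> \<complex>1\<close>. The norm is that of left multiplication operators on \<open>A\<close>; it is a
  C*-norm only for nonunital \<open>A\<close>, the only case in which this construction is used.\<close>

definition unitization :: "'a cstar \<Rightarrow> ('a \<times> complex) cstar" where
  "unitization A = \<lparr>
     carrier = carrier A \<times> UNIV,
     mult = (\<lambda>(a, \<alpha>) (b, \<beta>). (a \<otimes>\<^bsub>A\<^esub> b \<oplus>\<^bsub>A\<^esub> \<alpha> \<odot>\<^bsub>A\<^esub> b \<oplus>\<^bsub>A\<^esub> \<beta> \<odot>\<^bsub>A\<^esub> a, \<alpha> * \<beta>)),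
     one = (\<zero>\<^bsub>A\<^esub>, 1),
     zero = (\<zero>\<^bsub>A\<^esub>, 0),
     add = (\<lambda>(a, \<alpha>) (b, \<beta>). (a \<oplus>\<^bsub>A\<^esub> b, \<alpha> + \<beta>)),
     smult = (\<lambda>\<gamma> (a, \<alpha>). (\<gamma> \<odot>\<^bsub>A\<^esub> a, \<gamma> * \<alpha>)),
     star = (\<lambda>(a, \<alpha>). (star A a, cnj \<alpha>)),
     cnorm = (\<lambda>(a, \<alpha>). SUP b\<in>{b \<in> carrier A. cnorm A b \<le> 1}.
                cnorm A (a \<otimes>\<^bsub>A\<^esub> b \<oplus>\<^bsub>A\<^esub> \<alpha> \<odot>\<^bsub>A\<^esub> b))\<rparr>"

definition sub_cstar_algebra :: "'a set \<Rightarrow> ('a, 'm) cstar_scheme \<Rightarrow> bool" where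
  "sub_cstar_algebra S A \<longleftrightarrow>
     S \<subseteq> carrier A \<and> \<zero>\<^bsub>A\<^esub> \<in> S \<and>
     (\<forall>x\<in>S. \<forall>y\<in>S. x \<oplus>\<^bsub>A\<^esub> y \<in> S) \<and>
     (\<forall>\<alpha>. \<forall>x\<in>S. \<alpha> \<odot>\<^bsub>A\<^esub> x \<in> S) \<and>
     (\<forall>x\<in>S. \<forall>y\<in>S. x \<otimes>\<^bsub>A\<^esub> y \<in> S) \<and>
     (\<forall>x\<in>S. star A x \<in> S) \<and>
     closedin (ctopology A) S"

definition generated_cstar :: "('a, 'm) cstar_scheme \<Rightarrow> 'a set \<Rightarrow> 'a set" where
  "generated_cstar A X = \<Inter>{S. sub_cstar_algebra S A \<and> X \<subseteq> S}"

definition within_of :: "('a, 'm) cstar_scheme \<Rightarrow> 'a \<Rightarrow> real \<Rightarrow> 'a set \<Rightarrow> bool" where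
  "within_of A c \<epsilon> G \<longleftrightarrow> (\<exists>g\<in>G. cnorm A (c \<ominus>\<^bsub>A\<^esub> g) < \<epsilon>)"

definition generically_generated :: "('a, 'm) cstar_scheme \<Rightarrow> nat \<Rightarrow> bool" where
  "generically_generated A n \<longleftrightarrow>
     (\<forall>(a :: nat \<Rightarrow> 'a) \<epsilon> c. (\<forall>j\<le>n. a j \<in> self_adjoint A) \<and> 0 < \<epsilon> \<and> c \<in> carrier A \<longrightarrow>
        (\<exists>b. (\<forall>j\<le>n. b j \<in> self_adjoint A \<and> cnorm A (b j \<ominus>\<^bsub>A\<^esub> a j) < \<epsilon>) \<and>
             within_of A c \<epsilon> (generated_cstar A (b ` {..n}))))"

definition gr0 :: "('a, 'm) cstar_scheme \<Rightarrow> enat" where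
  "gr0 A = (if \<exists>n. generically_generated A n
            then enat (LEAST n. generically_generated A n) else \<infinity>)"

definition gr :: "'a cstar \<Rightarrow> enat" where
  "gr A = (if unital A then gr0 A else gr0 (unitization A))"

abbreviation subalg :: "'a cstar \<Rightarrow> 'a set \<Rightarrow> 'a cstar" where
  "subalg A S \<equiv> A\<lparr>carrier := S\<rparr>"

definition approximated_by :: "'a cstar \<Rightarrow> 'l set \<Rightarrow> ('l \<Rightarrow> 'a set) \<Rightarrow> bool" where
  "approximated_by A \<Lambda> B \<longleftrightarrow>
     (\<forall>l\<in>\<Lambda>. sub_cstar_algebra (B l) A) \<and>
     (\<forall>F \<epsilon>. finite F \<and> F \<subseteq> carrier A \<and> 0 < \<epsilon> \<longrightarrow> (\<exists>l\<in>\<Lambda>. \<forall>a\<in>F. within_of A a \<epsilon> (B l)))"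

definition star_hom :: "('a \<Rightarrow> 'b) \<Rightarrow> 'a cstar \<Rightarrow> 'b cstar \<Rightarrow> bool" where
  "star_hom h A B \<longleftrightarrow>
     (\<forall>x\<in>carrier A. h x \<in> carrier B) \<and>
     (\<forall>x\<in>carrier A. \<forall>y\<in>carrier A. h (x \<oplus>\<^bsub>A\<^esub> y) = h x \<oplus>\<^bsub>B\<^esub> h y) \<and>
     (\<forall>\<alpha>. \<forall>x\<in>carrier A. h (\<alpha> \<odot>\<^bsub>A\<^esub> x) = \<alpha> \<odot>\<^bsub>B\<^esub> h x) \<and>
     (\<forall>x\<in>carrier A. \<forall>y\<in>carrier A. h (x \<otimes>\<^bsub>A\<^esub> y) = h x \<otimes>\<^bsub>B\<^esub> h y) \<and>
     (\<forall>x\<in>carrier A. h (star A x) = star B (h x))"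

definition directed_set :: "'i set \<Rightarrow> ('i \<times> 'i) set \<Rightarrow> bool" where
  "directed_set J r \<longleftrightarrow> preorder_on J r \<and> J \<noteq> {} \<and>
     (\<forall>i\<in>J. \<forall>j\<in>J. \<exists>k\<in>J. (i, k) \<in> r \<and> (j, k) \<in> r)"

definition directed_filter :: "'i set \<Rightarrow> ('i \<times> 'i) set \<Rightarrow> 'i filter" where
  "directed_filter J r = (INF j\<in>J. principal {k \<in> J. (j, k) \<in> r})"

definition inductive_system ::
  "'i set \<Rightarrow> ('i \<times> 'i) set \<Rightarrow> ('i \<Rightarrow> 'b cstar) \<Rightarrow> ('i \<Rightarrow> 'i \<Rightarrow> 'b \<Rightarrow> 'b) \<Rightarrow> bool" where
  "inductive_system J r As \<phi> \<longleftrightarrow>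
     directed_set J r \<and>
     (\<forall>j\<in>J. cstar_algebra (As j)) \<and>
     (\<forall>i j. (i, j) \<in> r \<longrightarrow> star_hom (\<phi> i j) (As i) (As j)) \<and>
     (\<forall>i\<in>J. \<forall>x\<in>carrier (As i). \<phi> i i x = x) \<and>
     (\<forall>i j k. (i, j) \<in> r \<and> (j, k) \<in> r \<longrightarrow>
        (\<forall>x\<in>carrier (As i). \<phi> j k (\<phi> i j x) = \<phi> i k x))"

text \<open>The inductive limit is the Hausdorff completion of the algebraic direct limit for the seminorm
  sending the class of \<open>x \<in> A\<^sub>j\<close> to the limit of \<open>\<parallel>\<phi>\<^sub>j\<^sub>k(x)\<parallel>\<close> over \<open>k\<close>. It is determined up to
  isomorphism, so it is stated as a property of \<open>A\<close> and the canonical maps \<open>\<psi> j\<close>: compatible maps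
  \<open>\<psi> j\<close> are a *-homomorphism on the algebraic direct limit, which is to be isometric for that
  seminorm and to have dense range in the complete algebra \<open>A\<close>.\<close>

definition inductive_limit ::
  "'i set \<Rightarrow> ('i \<times> 'i) set \<Rightarrow> ('i \<Rightarrow> 'b cstar) \<Rightarrow> ('i \<Rightarrow> 'i \<Rightarrow> 'b \<Rightarrow> 'b)
     \<Rightarrow> 'a cstar \<Rightarrow> ('i \<Rightarrow> 'b \<Rightarrow> 'a) \<Rightarrow> bool" where
  "inductive_limit J r As \<phi> A \<psi> \<longleftrightarrow>
     inductive_system J r As \<phi> \<and>
     cstar_algebra A \<and>
     (\<forall>j\<in>J. star_hom (\<psi> j) (As j) A) \<and>
     (\<forall>i j. (i, j) \<in> r \<longrightarrow> (\<forall>x\<in>carrier (As i). \<psi> j (\<phi> i j x) = \<psi> i x)) \<and>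
     (\<forall>j\<in>J. \<forall>x\<in>carrier (As j).
        ((\<lambda>k. cnorm (As k) (\<phi> j k x)) \<longlongrightarrow> cnorm A (\<psi> j x)) (directed_filter J r)) \<and>
     ctopology A closure_of (\<Union>j\<in>J. \<psi> j ` carrier (As j)) = carrier A"

end

theory Submission
  imports Defs
begin

text \<open>Approximants of a given tuple lie in one algebra \<open>D\<close> mapping to \<open>A\<close>, so generic generators
  found near them in (the unitization of) \<open>D\<close> can be pushed forward; this only needs
  *-homomorphisms to be bounded. Boundedness is obtained without spectral theory: a small
  self-adjoint \<open>x\<close> is the real part of a unitary \<open>x + i(1 - w)\<close>, where \<open>w = (x\<^sup>2 + w\<^sup>2) / 2\<close> is
  a Banach fixed point, and the image of that unitary is isometric.

  If \<open>D\<close> is not unital, its unitization maps unitally to \<open>A\<close> or to the unitization of \<open>A\<close>. If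
  \<open>D\<close> has a unit \<open>p\<close> that is not mapped to the unit, one has to generate \<open>D \<oplus> \<complex>\<close> instead:
  shifting by nonzero scalars, one perturbs once to approximate the target and once more
  to generate \<open>p\<close> from the unshifted elements, which separates the two summands.\<close>

section \<open>Metric geometry of normed modules and C*-algebras\<close>

text \<open>When \<open>D\<close> has a unit \<open>p\<close>, \<open>gr D\<close> is blind to
  scalars: the generators it provides reach only \<open>h D\<close>, while the target must also
  reach multiples of its own unit \<open>e\<close>. Adding scalars to good generators is not enough,
  since the algebra generated by the sums \<open>h b + \<beta> e\<close> might not contain the two
  summands. They separate once \<open>h p\<close> multiplies that algebra into itself, and for this
  \<open>p\<close> has to lie exactly, not just approximately, in an algebra generated inside
  \<open>D\<close>. Exactness comes for free: a closed *-subalgebra at distance less than 1 from the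
  unit contains it. What remains is that one tuple must have two generation properties, before and
  after a shift. Lying near a generated algebra is an open condition on the generators, so a
  sufficiently small second perturbation preserves the first property.

  The homomorphisms into the target may have a kernel. Members of an inductive system can therefore
  be used directly, without passing to their images and without any statement about quotients, and
  both claims become instances of one approximation lemma.\<close>

lemma complex_ring_simps [simp]:
  "carrier complex_ring = UNIV" "add complex_ring = (+)" "mult complex_ring = (*)"
  "zero complex_ring = 0" "one complex_ring = 1"
  by (simp_all add: complex_ring_def)

lemma cring_complex_ring: "cring complex_ring"
proof (rule cringI)
  show "abelian_group complex_ring"
    by (rule abelian_groupI) (auto intro: exI[of _ "- x" for x])
  show "comm_monoid complex_ring"
    by (rule comm_monoidI) auto
qed (auto simp: algebra_simps)

lemma a_inv_complex_ring [simp]: "a_inv complex_ring x = - x"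
proof -
  interpret cring complex_ring by (rule cring_complex_ring)
  show ?thesis by (rule minus_equality) auto
qed

text \<open>The metric facts are needed for subalgebras and for the unitization before these are
  known to be C*-algebras, in particular to express their completeness by Cauchy sequences.\<close>

locale normed_cmodule = Module.module complex_ring A for A (structure) +
  assumes norm_nonneg: "x \<in> carrier A \<Longrightarrow> 0 \<le> cnorm A x"
    and norm_eq_zero: "x \<in> carrier A \<Longrightarrow> cnorm A x = 0 \<longleftrightarrow> x = \<zero>"
    and norm_triangle: "\<lbrakk>x \<in> carrier A; y \<in> carrier A\<rbrakk>
      \<Longrightarrow> cnorm A (x \<oplus> y) \<le> cnorm A x + cnorm A y"
    and norm_smult: "x \<in> carrier A \<Longrightarrow> cnorm A (\<alpha> \<odot> x) = cmod \<alpha> * cnorm A x"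
begin

lemma smult_simps [simp]:
  "x \<in> carrier A \<Longrightarrow> \<alpha> \<odot> x \<in> carrier A"
  "x \<in> carrier A \<Longrightarrow> 1 \<odot> x = x"
  "x \<in> carrier A \<Longrightarrow> 0 \<odot> x = \<zero>"
  "\<alpha> \<odot> \<zero> = \<zero>"
  "x \<in> carrier A \<Longrightarrow> \<alpha> \<odot> (\<beta> \<odot> x) = (\<alpha> * \<beta>) \<odot> x"
  "x \<in> carrier A \<Longrightarrow> (-1) \<odot> x = \<ominus> x"
  "x \<in> carrier A \<Longrightarrow> \<alpha> \<odot> (\<ominus> x) = \<ominus> (\<alpha> \<odot> x)"
  using smult_closed smult_one smult_l_null smult_r_null smult_assoc1[of \<alpha> \<beta> x]
    smult_l_minus[of 1 x] smult_r_minus[of \<alpha> x] by auto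

lemma smult_add: "x \<in> carrier A \<Longrightarrow> (\<alpha> + \<beta>) \<odot> x = \<alpha> \<odot> x \<oplus> \<beta> \<odot> x"
  using smult_l_distr[of \<alpha> \<beta> x] by simp

lemma smult_distr:
  "x \<in> carrier A \<Longrightarrow> y \<in> carrier A \<Longrightarrow> \<alpha> \<odot> (x \<oplus> y) = \<alpha> \<odot> x \<oplus> \<alpha> \<odot> y"
  using smult_r_distr[of \<alpha> x y] by simp

lemma smult_diff:
  "x \<in> carrier A \<Longrightarrow> y \<in> carrier A \<Longrightarrow> \<alpha> \<odot> (x \<ominus> y) = \<alpha> \<odot> x \<ominus> \<alpha> \<odot> y"
  by (simp add: M.minus_eq smult_distr)

lemma smult_minus: "x \<in> carrier A \<Longrightarrow> (- \<alpha>) \<odot> x = \<ominus> (\<alpha> \<odot> x)"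
  using smult_l_minus[of \<alpha> x] by simp

text \<open>An algebra without unit is not a \<open>ring\<close>, so its identities are supplied to
  the \<open>algebra\<close> method by hand; \<open>one A\<close> merely fills a slot of the
  signature.\<close>

lemmas group_simprules
  [algebra ring "zero A" "add A" "a_inv A" "a_minus A" "one A" "mult A"] =
  M.a_closed M.zero_closed M.a_inv_closed M.minus_closed M.a_assoc M.l_zero M.l_neg M.a_comm
  M.minus_eq M.r_zero M.r_neg M.r_neg2 M.r_neg1 M.minus_add M.minus_minus M.a_lcomm
  M.add.inv_one

lemma norm_zero [simp]: "cnorm A \<zero> = 0"
  by (simp add: norm_eq_zero)

lemma norm_uminus [simp]: "x \<in> carrier A \<Longrightarrow> cnorm A (\<ominus> x) = cnorm A x"
  using norm_smult[of x "-1"] by simp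

lemma norm_minus_commute:
  assumes "x \<in> carrier A" "y \<in> carrier A"
  shows "cnorm A (x \<ominus> y) = cnorm A (y \<ominus> x)"
proof -
  have "x \<ominus> y = \<ominus> (y \<ominus> x)"
    using assms by algebra
  then show ?thesis
    using assms by simp
qed

lemma minus_eq_zero_iff:
  assumes "x \<in> carrier A" "y \<in> carrier A"
  shows "x \<ominus> y = \<zero> \<longleftrightarrow> x = y"
proof
  assume "x \<ominus> y = \<zero>"
  moreover have "x = (x \<ominus> y) \<oplus> y"
    using assms by algebra
  ultimately show "x = y"
    using assms by simp
qed (use assms in algebra)

lemma norm_triangle_minus:
  assumes "x \<in> carrier A" "y \<in> carrier A" "z \<in> carrier A"
  shows "cnorm A (x \<ominus> z) \<le> cnorm A (x \<ominus> y) + cnorm A (y \<ominus> z)"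
proof -
  have "x \<ominus> z = (x \<ominus> y) \<oplus> (y \<ominus> z)"
    using assms by algebra
  then show ?thesis
    using norm_triangle[of "x \<ominus> y" "y \<ominus> z"] assms by simp
qed

lemma norm_le_minus:
  assumes "x \<in> carrier A" "y \<in> carrier A"
  shows "cnorm A x \<le> cnorm A (x \<ominus> y) + cnorm A y"
proof -
  have "x = (x \<ominus> y) \<oplus> y"
    using assms by algebra
  then show ?thesis
    using norm_triangle[of "x \<ominus> y" y] assms by simp
qed

lemma norm_minus_le:
  assumes "x \<in> carrier A" "y \<in> carrier A"
  shows "cnorm A (x \<ominus> y) \<le> cnorm A x + cnorm A y"
  using norm_triangle[of x "\<ominus> y"] assms by (simp add: M.minus_eq)

lemma norm_add_minus_add:
  assumes "x \<in> carrier A" "y \<in> carrier A" "x' \<in> carrier A" "y' \<in> carrier A"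
  shows "cnorm A ((x \<oplus> y) \<ominus> (x' \<oplus> y')) \<le> cnorm A (x \<ominus> x') + cnorm A (y \<ominus> y')"
proof -
  have "(x \<oplus> y) \<ominus> (x' \<oplus> y') = (x \<ominus> x') \<oplus> (y \<ominus> y')"
    using assms by algebra
  then show ?thesis
    using norm_triangle[of "x \<ominus> x'" "y \<ominus> y'"] assms by simp
qed

lemma norm_smult_minus_smult:
  assumes "x \<in> carrier A"
  shows "cnorm A (\<alpha> \<odot> x \<ominus> \<beta> \<odot> x) = cmod (\<alpha> - \<beta>) * cnorm A x"
  using norm_smult[of x "\<alpha> - \<beta>"] smult_add[of x \<alpha> "- \<beta>"] assms
  by (simp add: smult_minus M.minus_eq)

sublocale metric: Metric_space "carrier A" "cdist A"
proof
  fix x y z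
  show "cdist A x y = cdist A y x"
    using norm_minus_commute by (auto simp: cdist_def)
  show "x \<in> carrier A \<Longrightarrow> y \<in> carrier A \<Longrightarrow> cdist A x y = 0 \<longleftrightarrow> x = y"
    by (simp add: cdist_def norm_eq_zero minus_eq_zero_iff)
qed (auto simp: cdist_def norm_nonneg norm_triangle_minus)

lemma closedin_iff:
  "closedin (ctopology A) S \<longleftrightarrow>
    S \<subseteq> carrier A \<and> (\<forall>x\<in>carrier A. (\<forall>\<epsilon>>0. within_of A x \<epsilon> S) \<longrightarrow> x \<in> S)"
  unfolding metric.closedin_metric within_of_def disjnt_iff
  by (auto simp: cdist_def) (metis linorder_not_less subsetD)+

lemma closedinD:
  "\<lbrakk>closedin (ctopology A) S; x \<in> carrier A; \<And>\<epsilon>. \<epsilon> > 0 \<Longrightarrow> within_of A x \<epsilon> S\<rbrakk> \<Longrightarrow> x \<in> S"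
  by (simp add: closedin_iff)

lemma in_closure_iff:
  "S \<subseteq> carrier A \<Longrightarrow>
    x \<in> ctopology A closure_of S \<longleftrightarrow> x \<in> carrier A \<and> (\<forall>\<epsilon>>0. within_of A x \<epsilon> S)"
  unfolding metric.metric_closure_of within_of_def by (auto simp: cdist_def) blast+

lemma mcomplete_iff:
  "metric.mcomplete \<longleftrightarrow>
    (\<forall>\<sigma> :: nat \<Rightarrow> _. (\<forall>n. \<sigma> n \<in> carrier A) \<and>
         (\<forall>\<epsilon>>0. \<exists>N. \<forall>m\<ge>N. \<forall>n\<ge>N. cnorm A (\<sigma> m \<ominus> \<sigma> n) < \<epsilon>) \<longrightarrow>
       (\<exists>x\<in>carrier A. \<forall>\<epsilon>>0. \<exists>N. \<forall>n\<ge>N. cnorm A (\<sigma> n \<ominus> x) < \<epsilon>))"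
proof -
  have C: "metric.MCauchy \<sigma> \<longleftrightarrow> (\<forall>n. \<sigma> n \<in> carrier A) \<and>
      (\<forall>\<epsilon>>0. \<exists>N. \<forall>m\<ge>N. \<forall>n\<ge>N. cnorm A (\<sigma> m \<ominus> \<sigma> n) < \<epsilon>)" for \<sigma>
    unfolding metric.MCauchy_def by (auto simp: cdist_def image_subset_iff)
  have L: "limitin metric.mtopology \<sigma> x sequentially \<longleftrightarrow>
      x \<in> carrier A \<and> (\<forall>\<epsilon>>0. \<exists>N. \<forall>n\<ge>N. cnorm A (\<sigma> n \<ominus> x) < \<epsilon>)"
    if "\<forall>n. \<sigma> n \<in> carrier A" for \<sigma> x
    using that unfolding metric.limitin_metric eventually_sequentially by (auto simp: cdist_def)
  show ?thesis
    unfolding metric.mcomplete_def C by (intro arg_cong[where f = All] ext) (auto simp: L)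
qed

text \<open>Restricting to a closed subset \<open>S\<close> matters twice: the squaring map below
  contracts only on a small ball, and side conditions such as self-adjointness are carried to the
  fixed point by membership in \<open>S\<close>.\<close>

lemma contraction_fixpoint:
  assumes "metric.mcomplete" and S: "closedin (ctopology A) S" "S \<noteq> {}"
    and f: "\<And>x. x \<in> S \<Longrightarrow> f x \<in> S" and "k < 1"
    and contr: "\<And>x y. \<lbrakk>x \<in> S; y \<in> S\<rbrakk> \<Longrightarrow> cnorm A (f x \<ominus> f y) \<le> k * cnorm A (x \<ominus> y)"
  obtains x where "x \<in> S" "f x = x"
proof -
  have sub: "S \<subseteq> carrier A"
    using S by (simp add: closedin_iff)
  interpret Submetric "carrier A" "cdist A" S
    by unfold_locales (rule sub)
  have c: "sub.mcomplete"
    by (rule closedin_mcomplete_imp_mcomplete[OF S(1) assms(1)])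
  have d: "cdist A (f x) (f y) \<le> k * cdist A x y" if "x \<in> S" "y \<in> S" for x y
    using contr[OF that] that f sub by (simp add: cdist_def subset_iff)
  have "f \<in> S \<rightarrow> S"
    using f by blast
  from sub.Banach_fixedpoint_thm[OF c S(2) this \<open>k < 1\<close> d] show ?thesis
    using that by blast
qed

end

lemma normed_cmodule_cstar_algebra: "cstar_algebra A \<Longrightarrow> normed_cmodule A"
  unfolding cstar_algebra_def cstar_algebra_axioms_def normed_cmodule_def normed_cmodule_axioms_def
  by blast

sublocale cstar_algebra \<subseteq> normed_cmodule
  by (rule normed_cmodule_cstar_algebra) (rule cstar_algebra_axioms)

context cstar_algebra
begin

declare mult_closed [simp] star_closed [simp]

lemma mult_null [simp]:
  "x \<in> carrier A \<Longrightarrow> \<zero> \<otimes> x = \<zero>"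
  "x \<in> carrier A \<Longrightarrow> x \<otimes> \<zero> = \<zero>"
  using smult_mult_left[of \<zero> x 0] smult_mult_right[of x \<zero> 0] by auto

lemma mult_minus [simp]:
  "x \<in> carrier A \<Longrightarrow> y \<in> carrier A \<Longrightarrow> (\<ominus> x) \<otimes> y = \<ominus> (x \<otimes> y)"
  "x \<in> carrier A \<Longrightarrow> y \<in> carrier A \<Longrightarrow> x \<otimes> (\<ominus> y) = \<ominus> (x \<otimes> y)"
  using smult_mult_left[of x y "-1"] smult_mult_right[of x y "-1"] by auto

lemmas cstar_simprules
  [algebra ring "zero A" "add A" "a_inv A" "a_minus A" "one A" "mult A"] =
  mult_closed mult_assoc mult_l_distr mult_r_distr mult_null mult_minus

lemma star_zero [simp]: "star A \<zero> = \<zero>"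
  using star_smult[of \<zero> 0] by simp

lemma star_uminus [simp]: "x \<in> carrier A \<Longrightarrow> star A (\<ominus> x) = \<ominus> star A x"
  using star_smult[of x "-1"] by simp

lemma star_minus: "x \<in> carrier A \<Longrightarrow> y \<in> carrier A \<Longrightarrow> star A (x \<ominus> y) = star A x \<ominus> star A y"
  by (simp add: M.minus_eq star_add)

lemma norm_star [simp]:
  assumes "x \<in> carrier A"
  shows "cnorm A (star A x) = cnorm A x"
proof -
  have le: "cnorm A y \<le> cnorm A (star A y)" if "y \<in> carrier A" for y
  proof (cases "cnorm A y = 0")
    case False
    have "cnorm A y * cnorm A y \<le> cnorm A (star A y) * cnorm A y"
      using cstar_identity[OF that] norm_mult[of "star A y" y] that by (simp add: power2_eq_square)
    then show ?thesis
      using False norm_nonneg[OF that] by simp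
  qed (use that in \<open>simp add: norm_nonneg\<close>)
  show ?thesis
    using le[of x] le[of "star A x"] assms by (simp add: star_star)
qed

lemma norm_mult_minus_mult:
  assumes "x \<in> carrier A" "y \<in> carrier A" "x' \<in> carrier A" "y' \<in> carrier A"
  shows "cnorm A ((x \<otimes> y) \<ominus> (x' \<otimes> y'))
    \<le> cnorm A x * cnorm A (y \<ominus> y') + cnorm A (x \<ominus> x') * cnorm A y'"
proof -
  have "(x \<otimes> y) \<ominus> (x' \<otimes> y') = x \<otimes> (y \<ominus> y') \<oplus> (x \<ominus> x') \<otimes> y'"
    using assms by algebra
  then show ?thesis
    using norm_triangle[of "x \<otimes> (y \<ominus> y')" "(x \<ominus> x') \<otimes> y'"]
      norm_mult[of x "y \<ominus> y'"] norm_mult[of "x \<ominus> x'" y'] assms by simp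
qed

lemma self_adjoint_add:
  "x \<in> self_adjoint A \<Longrightarrow> y \<in> self_adjoint A \<Longrightarrow> x \<oplus> y \<in> self_adjoint A"
  by (simp add: self_adjoint_def star_add)

lemma self_adjoint_smult:
  "x \<in> self_adjoint A \<Longrightarrow> \<alpha> \<in> \<real> \<Longrightarrow> \<alpha> \<odot> x \<in> self_adjoint A"
  by (simp add: self_adjoint_def star_smult Reals_cnj_iff)

end

context normed_cmodule
begin

declare M.add.inv_one [simp]

lemma minus_zero_right [simp]: "x \<in> carrier A \<Longrightarrow> x \<ominus> \<zero> = x"
  by (simp add: M.minus_eq)

lemma within_of_triangle:
  assumes "within_of A x \<epsilon> S" "S \<subseteq> carrier A" "x \<in> carrier A" "y \<in> carrier A" "cnorm A (y \<ominus> x) \<le> \<eta>"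
  shows "within_of A y (\<eta> + \<epsilon>) S"
proof -
  obtain s where s: "s \<in> S" "cnorm A (x \<ominus> s) < \<epsilon>"
    using assms(1) by (auto simp: within_of_def)
  then have "cnorm A (y \<ominus> s) < \<eta> + \<epsilon>"
    using norm_triangle_minus[of y x s] assms by fastforce
  then show ?thesis
    using s by (auto simp: within_of_def)
qed

lemma closedin_zero: "closedin (ctopology A) {\<zero>}"
proof -
  have "x = \<zero>" if x: "x \<in> carrier A" and small: "\<forall>\<epsilon>>0. within_of A x \<epsilon> {\<zero>}" for x
  proof (rule ccontr)
    assume "x \<noteq> \<zero>"
    then have "cnorm A x > 0"
      using norm_eq_zero[OF x] norm_nonneg[OF x] by simp
    then show False
      using small x by (auto simp: within_of_def)
  qed
  then show ?thesis
    by (simp add: closedin_iff)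
qed

end

text \<open>Common source of closedness for self-adjoint parts, commutants, idealizers and preimages
  under homomorphisms. The sign of \<open>K\<close> is left open, hence the divisor
  \<open>\<bar>K\<bar> + 1\<close> in the proof.\<close>

lemma closedin_vimage_Lipschitz:
  assumes "normed_cmodule A" "normed_cmodule B" "closedin (ctopology B) T"
    and f: "\<And>x. x \<in> carrier A \<Longrightarrow> f x \<in> carrier B"
    and L: "\<And>x y. \<lbrakk>x \<in> carrier A; y \<in> carrier A\<rbrakk>
      \<Longrightarrow> cnorm B (f x \<ominus>\<^bsub>B\<^esub> f y) \<le> K * cnorm A (x \<ominus>\<^bsub>A\<^esub> y)"
  shows "closedin (ctopology A) {x \<in> carrier A. f x \<in> T}"
proof -
  interpret A: normed_cmodule A by fact
  interpret B: normed_cmodule B by fact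
  have "f x \<in> T" if x: "x \<in> carrier A" and
    lim: "\<And>\<epsilon>. \<epsilon> > 0 \<Longrightarrow> within_of A x \<epsilon> {x \<in> carrier A. f x \<in> T}" for x
  proof (rule B.closedinD[OF assms(3)])
    fix \<epsilon> :: real assume "\<epsilon> > 0"
    then have "\<epsilon> / (\<bar>K\<bar> + 1) > 0"
      by simp
    from lim[OF this] obtain y where y: "y \<in> carrier A" "f y \<in> T"
      and less: "cnorm A (x \<ominus>\<^bsub>A\<^esub> y) < \<epsilon> / (\<bar>K\<bar> + 1)"
      by (auto simp: within_of_def)
    have "cnorm B (f x \<ominus>\<^bsub>B\<^esub> f y) \<le> K * cnorm A (x \<ominus>\<^bsub>A\<^esub> y)"
      using x y L by blast
    also have "\<dots> \<le> (\<bar>K\<bar> + 1) * cnorm A (x \<ominus>\<^bsub>A\<^esub> y)"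
      using x y by (intro mult_right_mono) (auto simp: A.norm_nonneg)
    also have "\<dots> < \<epsilon>"
      using less by (simp add: field_simps)
    finally show "within_of B (f x) \<epsilon> T"
      using y by (auto simp: within_of_def)
  qed (use f x in auto)
  then show ?thesis
    by (auto simp: A.closedin_iff)
qed

section \<open>Closed *-subalgebras, points on the unit circle, and units from near-units\<close>

context cstar_algebra
begin

lemma sub_cstarD:
  assumes "sub_cstar_algebra S A"
  shows "S \<subseteq> carrier A" "x \<in> S \<Longrightarrow> x \<in> carrier A" "\<zero> \<in> S"
    "\<lbrakk>x \<in> S; y \<in> S\<rbrakk> \<Longrightarrow> x \<oplus> y \<in> S" "x \<in> S \<Longrightarrow> \<alpha> \<odot> x \<in> S"
    "\<lbrakk>x \<in> S; y \<in> S\<rbrakk> \<Longrightarrow> x \<otimes> y \<in> S" "x \<in> S \<Longrightarrow> star A x \<in> S"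
    "closedin (ctopology A) S"
  using assms by (auto simp: sub_cstar_algebra_def)

lemma sub_cstar_minus:
  assumes "sub_cstar_algebra S A" "x \<in> S" "y \<in> S"
  shows "x \<ominus> y \<in> S"
proof -
  have "x \<ominus> y = x \<oplus> (-1) \<odot> y"
    using sub_cstarD(2)[OF assms(1,3)] by (simp add: M.minus_eq)
  then show ?thesis
    using assms sub_cstarD(4,5)[OF assms(1)] by metis
qed

lemma sub_cstar_carrier: "sub_cstar_algebra (carrier A) A"
  by (auto simp: sub_cstar_algebra_def closedin_iff)

lemma sub_cstar_generated:
  assumes "X \<subseteq> carrier A"
  shows "sub_cstar_algebra (generated_cstar A X) A"
proof -
  have "closedin (ctopology A) (generated_cstar A X)"
    unfolding generated_cstar_def using sub_cstar_carrier assms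
    by (intro closedin_Inter) (auto simp: sub_cstar_algebra_def)
  then show ?thesis
    using sub_cstar_carrier assms
    by (auto simp: generated_cstar_def sub_cstar_algebra_def)
qed

lemma sub_generated: "X \<subseteq> generated_cstar A X"
  by (auto simp: generated_cstar_def)

lemma generated_least: "\<lbrakk>sub_cstar_algebra S A; X \<subseteq> S\<rbrakk> \<Longrightarrow> generated_cstar A X \<subseteq> S"
  by (auto simp: generated_cstar_def)

lemma generated_mono: "X \<subseteq> Y \<Longrightarrow> generated_cstar A X \<subseteq> generated_cstar A Y"
  by (auto simp: generated_cstar_def)

lemma closedin_self_adjoint: "closedin (ctopology A) (self_adjoint A)"
proof -
  have "closedin (ctopology A) {x \<in> carrier A. star A x \<ominus> x \<in> {\<zero>}}"
  proof (rule closedin_vimage_Lipschitz[OF normed_cmodule_axioms normed_cmodule_axioms closedin_zero])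
    fix x y assume xy: "x \<in> carrier A" "y \<in> carrier A"
    have "star A x \<ominus> x \<ominus> (star A y \<ominus> y) = star A (x \<ominus> y) \<ominus> (x \<ominus> y)"
      using xy star_closed[OF xy(1)] star_closed[OF xy(2)] unfolding star_minus[OF xy] by algebra
    then show "cnorm A (star A x \<ominus> x \<ominus> (star A y \<ominus> y)) \<le> 2 * cnorm A (x \<ominus> y)"
      using norm_minus_le[of "star A (x \<ominus> y)" "x \<ominus> y"] xy by simp
  qed simp
  moreover have "{x \<in> carrier A. star A x \<ominus> x \<in> {\<zero>}} = self_adjoint A"
    by (auto simp: self_adjoint_def minus_eq_zero_iff)
  ultimately show ?thesis
    by simp
qed

lemma closedin_commutant:
  assumes a: "a \<in> carrier A"
  shows "closedin (ctopology A) {x \<in> carrier A. x \<otimes> a = a \<otimes> x}"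
proof -
  have "closedin (ctopology A) {x \<in> carrier A. x \<otimes> a \<ominus> a \<otimes> x \<in> {\<zero>}}"
  proof (rule closedin_vimage_Lipschitz[OF normed_cmodule_axioms normed_cmodule_axioms closedin_zero])
    fix x y assume xy: "x \<in> carrier A" "y \<in> carrier A"
    have "x \<otimes> a \<ominus> a \<otimes> x \<ominus> (y \<otimes> a \<ominus> a \<otimes> y) = (x \<ominus> y) \<otimes> a \<ominus> a \<otimes> (x \<ominus> y)"
      using xy a by algebra
    then show "cnorm A (x \<otimes> a \<ominus> a \<otimes> x \<ominus> (y \<otimes> a \<ominus> a \<otimes> y)) \<le> 2 * cnorm A a * cnorm A (x \<ominus> y)"
      using norm_minus_le[of "(x \<ominus> y) \<otimes> a" "a \<otimes> (x \<ominus> y)"]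
        norm_mult[of "x \<ominus> y" a] norm_mult[of a "x \<ominus> y"] xy a by (simp add: algebra_simps)
  qed (use a in simp)
  then show ?thesis
    using a by (simp add: minus_eq_zero_iff cong: conj_cong)
qed

lemma closedin_cball: "closedin (ctopology A) {x \<in> carrier A. cnorm A x \<le> r}"
proof -
  have "{x \<in> carrier A. cnorm A x \<le> r} = metric.mcball \<zero> r"
    by (auto simp: cdist_def norm_minus_commute[of \<zero>] M.minus_eq)
  then show ?thesis
    by (simp add: metric.closedin_mcball)
qed

text \<open>Read with \<open>w = 1 - v\<close>, the equation says \<open>x\<^sup>2 + v\<^sup>2 = 1\<close>.\<close>

lemma circle_point_exists:
  assumes x: "x \<in> self_adjoint A" and le: "cnorm A x \<le> 1 / 2"
  obtains w where "w \<in> self_adjoint A" "w \<otimes> x = x \<otimes> w" "w \<oplus> w = x \<otimes> x \<oplus> w \<otimes> w"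
proof -
  have xA [simp]: "x \<in> carrier A" and sx: "star A x = x"
    using x by (auto simp: self_adjoint_def)
  \<comment> \<open>On the ball of radius 1/2 each square has norm at most 1/4, so \<open>f\<close>
    maps the ball into itself; there squaring has Lipschitz constant 1, and the factor 1/2 in
    \<open>f\<close> makes it a contraction. Commuting with \<open>x\<close> is put into
    \<open>S\<close> so that the fixed point inherits it.\<close>
  define S where "S = self_adjoint A \<inter> {z \<in> carrier A. z \<otimes> x = x \<otimes> z} \<inter> {z \<in> carrier A. cnorm A z \<le> 1/2}"
  define f where "f z = (1/2) \<odot> (x \<otimes> x \<oplus> z \<otimes> z)" for z
  have cl: "closedin (ctopology A) S"
    unfolding S_def by (intro closedin_Int closedin_self_adjoint closedin_commutant closedin_cball xA)
  have "\<zero> \<in> S"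
    by (simp add: S_def self_adjoint_def)
  then have ne: "S \<noteq> {}"
    by blast
  have sq: "cnorm A (z \<otimes> z) \<le> 1/4" if "z \<in> carrier A" "cnorm A z \<le> 1/2" for z
    using norm_mult[of z z] mult_mono[of "cnorm A z" "1/2" "cnorm A z" "1/2"] that norm_nonneg[of z]
    by simp
  have fS: "f z \<in> S" if "z \<in> S" for z
  proof -
    have z: "z \<in> carrier A" "star A z = z" "z \<otimes> x = x \<otimes> z" "cnorm A z \<le> 1/2"
      using that by (auto simp: S_def self_adjoint_def)
    have "z \<otimes> z \<otimes> x = x \<otimes> (z \<otimes> z)"
      using z by (metis xA mult_assoc)
    then have "f z \<otimes> x = x \<otimes> f z"
      using z by (simp add: f_def smult_mult_left smult_mult_right mult_l_distr mult_r_distr mult_assoc)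
    moreover have "cnorm A (f z) \<le> 1/2"
      using norm_triangle[of "x \<otimes> x" "z \<otimes> z"] sq[of x] sq[of z] z le
      by (simp add: f_def norm_smult)
    moreover have "star A (f z) = f z"
      using z sx by (simp add: f_def star_smult star_add star_mult)
    ultimately show ?thesis
      using z by (simp add: S_def self_adjoint_def f_def)
  qed
  have contr: "cnorm A (f y \<ominus> f z) \<le> 1/2 * cnorm A (y \<ominus> z)" if "y \<in> S" "z \<in> S" for y z
  proof -
    have yz: "y \<in> carrier A" "z \<in> carrier A" "cnorm A y \<le> 1/2" "cnorm A z \<le> 1/2"
      using that by (auto simp: S_def)
    have "(x \<otimes> x \<oplus> y \<otimes> y) \<ominus> (x \<otimes> x \<oplus> z \<otimes> z) = (y \<otimes> y) \<ominus> (z \<otimes> z)"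
      using yz xA by algebra
    then have "f y \<ominus> f z = (1/2) \<odot> ((y \<otimes> y) \<ominus> (z \<otimes> z))"
      using yz by (simp add: f_def smult_diff[symmetric])
    then have "cnorm A (f y \<ominus> f z) = 1/2 * cnorm A ((y \<otimes> y) \<ominus> (z \<otimes> z))"
      using yz by (simp add: norm_smult)
    also have "\<dots> \<le> 1/2 * (cnorm A y * cnorm A (y \<ominus> z) + cnorm A (y \<ominus> z) * cnorm A z)"
      using norm_mult_minus_mult[of y y z z] yz by simp
    also have "\<dots> \<le> 1/2 * (1/2 * cnorm A (y \<ominus> z) + cnorm A (y \<ominus> z) * (1/2))"
      using yz by (intro mult_left_mono add_mono mult_right_mono) (auto simp: norm_nonneg)
    finally show ?thesis
      by simp
  qed
  obtain w where w: "w \<in> S" "f w = w"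
    using contraction_fixpoint[OF complete cl ne fS _ contr] by (metis one_less_numeral_iff semiring_norm(76) divide_less_eq_1_pos zero_less_numeral)
  have wA: "w \<in> carrier A"
    using w by (simp add: S_def)
  have "w \<oplus> w = 2 \<odot> f w"
    using w wA smult_add[of w 1 1] by simp
  also have "\<dots> = x \<otimes> x \<oplus> w \<otimes> w"
    using wA by (simp add: f_def)
  finally show ?thesis
    using that w by (auto simp: S_def)
qed

text \<open>The elements \<open>u = y \<plusminus> i(1 - w)\<close> of the unitization satisfy \<open>u\<^sup>*u = 1\<close>, and their mean is \<open>y\<close>.\<close>

lemma norm_circle_mult_le:
  assumes y: "y \<in> self_adjoint A" and w: "w \<in> self_adjoint A"
    and comm: "w \<otimes> y = y \<otimes> w" and circle: "w \<oplus> w = y \<otimes> y \<oplus> w \<otimes> w"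
    and c: "c \<in> carrier A"
  shows "cnorm A (y \<otimes> c) \<le> cnorm A c"
proof -
  have [simp]: "y \<in> carrier A" "w \<in> carrier A" "star A y = y" "star A w = w" "c \<in> carrier A"
    using y w c by (auto simp: self_adjoint_def)
  define d where "d = star A c"
  \<comment> \<open>\<open>v\<close> is \<open>(1 - w) c\<close>: with no unit at hand,
    \<open>1 - w\<close> appears only through its action on \<open>c\<close>.\<close>
  define v where "v = c \<ominus> w \<otimes> c"
  have [simp]: "d \<in> carrier A" "v \<in> carrier A"
    by (simp_all add: d_def v_def)
  have mem: "y \<in> carrier A" "w \<in> carrier A" "c \<in> carrier A" "d \<in> carrier A"
    by simp_all
  have sv: "star A v = d \<ominus> d \<otimes> w"
    by (simp add: v_def d_def star_minus star_mult)
  have sy: "star A (y \<otimes> c) = d \<otimes> y"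
    by (simp add: d_def star_mult)
  have yv: "(d \<otimes> y) \<otimes> v = (d \<ominus> d \<otimes> w) \<otimes> (y \<otimes> c)"
  proof -
    have "(d \<otimes> y) \<otimes> v = d \<otimes> y \<otimes> c \<ominus> d \<otimes> (y \<otimes> w) \<otimes> c"
      unfolding v_def using mem by algebra
    also have "\<dots> = (d \<ominus> d \<otimes> w) \<otimes> (y \<otimes> c)"
      unfolding comm[symmetric] using mem by algebra
    finally show ?thesis .
  qed
  have yy: "y \<otimes> y = w \<oplus> w \<ominus> w \<otimes> w"
    unfolding circle using mem by algebra
  have vv: "(d \<otimes> y) \<otimes> (y \<otimes> c) \<oplus> (d \<ominus> d \<otimes> w) \<otimes> v = d \<otimes> c"
  proof -
    have "(d \<otimes> y) \<otimes> (y \<otimes> c) = d \<otimes> (y \<otimes> y) \<otimes> c"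
      by (simp add: mult_assoc)
    also have "\<dots> = d \<otimes> (w \<oplus> w \<ominus> w \<otimes> w) \<otimes> c"
      by (simp add: yy)
    finally show ?thesis
      unfolding v_def using mem by (simp only:) algebra
  qed
  \<comment> \<open>\<open>\<iota>\<close> will be \<open>\<i>\<close> and \<open>-\<i>\<close>. In
    the product of the element with its adjoint the mixed terms cancel by \<open>yv\<close>, because
    \<open>y\<close> commutes with \<open>w\<close>; the rest is
    \<open>c* (y y + (1 - w)(1 - w)) c = c* c\<close> by \<open>vv\<close>.\<close>
  have norm_u: "cnorm A (y \<otimes> c \<oplus> \<iota> \<odot> v) = cnorm A c" if "cnj \<iota> = - \<iota>" "\<iota> * \<iota> = -1" for \<iota>
  proof -
    have "star A (y \<otimes> c \<oplus> \<iota> \<odot> v) = d \<otimes> y \<oplus> (- \<iota>) \<odot> (d \<ominus> d \<otimes> w)"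
      by (simp add: star_add star_smult sv sy that)
    then have "star A (y \<otimes> c \<oplus> \<iota> \<odot> v) \<otimes> (y \<otimes> c \<oplus> \<iota> \<odot> v)
        = (d \<otimes> y) \<otimes> (y \<otimes> c) \<oplus> \<iota> \<odot> ((d \<otimes> y) \<otimes> v)
          \<oplus> ((- \<iota>) \<odot> ((d \<ominus> d \<otimes> w) \<otimes> (y \<otimes> c)) \<oplus> (d \<ominus> d \<otimes> w) \<otimes> v)"
      using that by (simp add: mult_l_distr mult_r_distr smult_mult_left smult_mult_right smult_distr M.a_ac)
    also have "\<dots> = ((d \<otimes> y) \<otimes> (y \<otimes> c) \<oplus> (d \<ominus> d \<otimes> w) \<otimes> v)
          \<oplus> (\<iota> \<odot> ((d \<otimes> y) \<otimes> v) \<oplus> (- \<iota>) \<odot> ((d \<otimes> y) \<otimes> v))"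
      unfolding yv by (simp add: M.a_ac)
    also have "\<dots> = d \<otimes> c"
      unfolding vv by (simp add: smult_add[symmetric])
    finally have "star A (y \<otimes> c \<oplus> \<iota> \<odot> v) \<otimes> (y \<otimes> c \<oplus> \<iota> \<odot> v) = star A c \<otimes> c"
      by (simp add: d_def)
    then have "(cnorm A (y \<otimes> c \<oplus> \<iota> \<odot> v))\<^sup>2 = (cnorm A c)\<^sup>2"
      by (simp add: cstar_identity[symmetric])
    then show ?thesis
      by (simp add: norm_nonneg)
  qed
  have "(y \<otimes> c \<oplus> \<i> \<odot> v) \<oplus> (y \<otimes> c \<oplus> (-\<i>) \<odot> v) = (y \<otimes> c \<oplus> y \<otimes> c) \<oplus> (\<i> \<odot> v \<oplus> (-\<i>) \<odot> v)"
    by (simp add: M.a_ac)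
  also have "\<dots> = 2 \<odot> (y \<otimes> c)"
    using smult_add[of "y \<otimes> c" 1 1] by (simp add: smult_add[symmetric])
  finally have "2 * cnorm A (y \<otimes> c) = cnorm A ((y \<otimes> c \<oplus> \<i> \<odot> v) \<oplus> (y \<otimes> c \<oplus> (-\<i>) \<odot> v))"
    by (simp add: norm_smult)
  also have "\<dots> \<le> 2 * cnorm A c"
    using norm_triangle[of "y \<otimes> c \<oplus> \<i> \<odot> v" "y \<otimes> c \<oplus> (-\<i>) \<odot> v"] norm_u[of \<i>] norm_u[of "-\<i>"] by simp
  finally show ?thesis
    by simp
qed

text \<open>If \<open>1 - x\<close> acts on \<open>S\<close> as a strict contraction,
  \<open>x\<close> should be invertible. The fixed point of \<open>s \<mapsto> x + (1 - x) s\<close>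
  satisfies \<open>x s = x\<close>, so \<open>x\<close> annihilates every \<open>s b - b\<close>;
  such an element is moved by \<open>1 - x\<close> to itself, hence is zero.\<close>

lemma left_unit_of_near:
  assumes S: "sub_cstar_algebra S A" and x: "x \<in> S" and "k < 1"
    and near: "\<And>b. b \<in> S \<Longrightarrow> cnorm A (b \<ominus> x \<otimes> b) \<le> k * cnorm A b"
  obtains s where "s \<in> S" "\<And>b. b \<in> S \<Longrightarrow> s \<otimes> b = b"
proof -
  note [simp] = sub_cstarD(2)[OF S]
  define f where "f s = x \<oplus> (s \<ominus> x \<otimes> s)" for s
  have fS: "f s \<in> S" if "s \<in> S" for s
    using that x sub_cstarD[OF S] sub_cstar_minus[OF S] by (simp add: f_def)
  have contr: "cnorm A (f s \<ominus> f t) \<le> k * cnorm A (s \<ominus> t)" if st: "s \<in> S" "t \<in> S" for s t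
  proof -
    have "f s \<ominus> f t = (s \<ominus> t) \<ominus> x \<otimes> (s \<ominus> t)"
      using sub_cstarD(2)[OF S st(1)] sub_cstarD(2)[OF S st(2)] sub_cstarD(2)[OF S x] unfolding f_def by algebra
    then show ?thesis
      using near[of "s \<ominus> t"] sub_cstar_minus[OF S st] by simp
  qed
  have ne: "S \<noteq> {}"
    using x by blast
  obtain s where s: "s \<in> S" "f s = s"
    by (rule contraction_fixpoint[OF complete sub_cstarD(8)[OF S] ne fS \<open>k < 1\<close> contr])
  have [simp]: "x \<in> carrier A" "s \<in> carrier A"
    using s x by simp_all
  then have mem: "x \<in> carrier A" "s \<in> carrier A"
    by simp_all
  have "x \<ominus> x \<otimes> s = f s \<ominus> s"
    unfolding f_def using mem by algebra
  then have xs: "x \<otimes> s = x"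
    using s minus_eq_zero_iff[of x "x \<otimes> s"] minus_eq_zero_iff[of s s] by simp
  have "s \<otimes> b = b" if "b \<in> S" for b
  proof -
    have b: "b \<in> carrier A"
      using that by simp
    define c where "c = s \<otimes> b \<ominus> b"
    have c: "c \<in> S"
      using that s sub_cstarD[OF S] sub_cstar_minus[OF S] by (simp add: c_def)
    have "x \<otimes> c = (x \<otimes> s) \<otimes> b \<ominus> x \<otimes> b"
      unfolding c_def using mem b by algebra
    also have "\<dots> = \<zero>"
      using b by (simp add: xs minus_eq_zero_iff)
    finally have "cnorm A c \<le> k * cnorm A c"
      using near[OF c] sub_cstarD(2)[OF S c] by simp
    then have "(1 - k) * cnorm A c \<le> 0"
      by (simp add: algebra_simps)
    then have "cnorm A c = 0"
      using \<open>k < 1\<close> norm_nonneg[of c] c by (simp add: mult_le_0_iff)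
    then show ?thesis
      using c b by (simp add: norm_eq_zero c_def minus_eq_zero_iff)
  qed
  then show ?thesis
    using that s by blast
qed

text \<open>An element of \<open>S\<close> close to \<open>p\<close> acts almost as the identity, so
  \<open>S\<close> has a left unit of its own, and that unit turns out to be \<open>p\<close>. This
  upgrades approximate generation of the unit to exact generation.\<close>

lemma unit_in_sub_cstar:
  assumes S: "sub_cstar_algebra S A" and p: "p \<in> carrier A"
    and unit: "\<And>a. a \<in> carrier A \<Longrightarrow> p \<otimes> a = a \<and> a \<otimes> p = a"
    and near: "within_of A p 1 S"
  shows "p \<in> S"
proof -
  obtain x where x: "x \<in> S" "cnorm A (p \<ominus> x) < 1"
    using near by (auto simp: within_of_def)
  have xA: "x \<in> carrier A"
    using sub_cstarD(2)[OF S x(1)] .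
  have "cnorm A (b \<ominus> x \<otimes> b) \<le> cnorm A (p \<ominus> x) * cnorm A b" if "b \<in> S" for b
  proof -
    have b: "b \<in> carrier A"
      using sub_cstarD(2)[OF S that] .
    have "(p \<ominus> x) \<otimes> b = p \<otimes> b \<ominus> x \<otimes> b"
      using b p xA by algebra
    then show ?thesis
      using norm_mult[of "p \<ominus> x" b] b p xA unit by simp
  qed
  then obtain s where s: "s \<in> S" "\<And>b. b \<in> S \<Longrightarrow> s \<otimes> b = b"
    using left_unit_of_near[OF S x] by blast
  have sA: "s \<in> carrier A"
    using sub_cstarD(2)[OF S s(1)] .
  have "p \<otimes> x \<ominus> s \<otimes> x = \<zero>"
    using s(2)[OF x(1)] unit xA by (simp add: minus_eq_zero_iff)
  \<comment> \<open>\<open>p - s\<close> annihilates \<open>x\<close>, so it is unchanged by right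
    multiplication with \<open>p - x\<close>, whose norm is below 1; hence it vanishes.\<close>
  then have "(p \<ominus> s) \<otimes> x = \<zero>"
    using p sA xA by (simp add: M.minus_eq mult_l_distr)
  moreover have "(p \<ominus> s) \<otimes> (p \<ominus> x) = (p \<ominus> s) \<otimes> p \<ominus> (p \<ominus> s) \<otimes> x"
    using p sA xA by algebra
  ultimately have "p \<ominus> s = (p \<ominus> s) \<otimes> (p \<ominus> x)"
    using unit p sA xA by (simp add: M.minus_eq)
  then have "cnorm A (p \<ominus> s) \<le> cnorm A (p \<ominus> s) * cnorm A (p \<ominus> x)"
    using norm_mult[of "p \<ominus> s" "p \<ominus> x"] p sA xA by simp
  then have "cnorm A (p \<ominus> s) * (1 - cnorm A (p \<ominus> x)) \<le> 0"
    by (simp add: algebra_simps)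
  then have "cnorm A (p \<ominus> s) = 0"
    using x norm_nonneg[of "p \<ominus> s"] p sA by (simp add: mult_le_0_iff)
  then have "p = s"
    using p sA by (simp add: norm_eq_zero minus_eq_zero_iff)
  then show ?thesis
    using s by simp
qed

end

section \<open>Boundedness of *-homomorphisms and stability of generated subalgebras\<close>

locale cstar_hom = D: cstar_algebra D + E: cstar_algebra E
  for D :: "'b cstar" and E :: "'a cstar" and h :: "'b \<Rightarrow> 'a" +
  assumes star_hom: "star_hom h D E"
begin

lemma hom_closed [simp]: "x \<in> carrier D \<Longrightarrow> h x \<in> carrier E"
  and hom_add: "x \<in> carrier D \<Longrightarrow> y \<in> carrier D \<Longrightarrow> h (x \<oplus>\<^bsub>D\<^esub> y) = h x \<oplus>\<^bsub>E\<^esub> h y"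
  and hom_smult: "x \<in> carrier D \<Longrightarrow> h (\<alpha> \<odot>\<^bsub>D\<^esub> x) = \<alpha> \<odot>\<^bsub>E\<^esub> h x"
  and hom_mult: "x \<in> carrier D \<Longrightarrow> y \<in> carrier D \<Longrightarrow> h (x \<otimes>\<^bsub>D\<^esub> y) = h x \<otimes>\<^bsub>E\<^esub> h y"
  and hom_star: "x \<in> carrier D \<Longrightarrow> h (star D x) = star E (h x)"
  using star_hom by (auto simp: star_hom_def)

lemma hom_zero [simp]: "h \<zero>\<^bsub>D\<^esub> = \<zero>\<^bsub>E\<^esub>"
  using hom_smult[of "\<zero>\<^bsub>D\<^esub>" 0] by simp

lemma hom_minus:
  assumes "x \<in> carrier D" "y \<in> carrier D"
  shows "h (x \<ominus>\<^bsub>D\<^esub> y) = h x \<ominus>\<^bsub>E\<^esub> h y"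
  using assms hom_add[of x "\<ominus>\<^bsub>D\<^esub> y"] hom_smult[of y "-1"]
  by (simp add: D.M.minus_eq E.M.minus_eq)

lemma hom_self_adjoint: "x \<in> self_adjoint D \<Longrightarrow> h x \<in> self_adjoint E"
  by (auto simp: self_adjoint_def hom_star[symmetric])

text \<open>The circle equation and the commutation are algebraic, so \<open>h\<close> transports
  them to \<open>E\<close>. The multiplication estimate with \<open>c = h x\<close> then bounds the
  square of \<open>cnorm E (h x)\<close> by \<open>cnorm E (h x)\<close> itself.\<close>

lemma norm_hom_le_one:
  assumes x: "x \<in> self_adjoint D" and le: "cnorm D x \<le> 1/2"
  shows "cnorm E (h x) \<le> 1"
proof -
  obtain w where w: "w \<in> self_adjoint D" "w \<otimes>\<^bsub>D\<^esub> x = x \<otimes>\<^bsub>D\<^esub> w"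
    "w \<oplus>\<^bsub>D\<^esub> w = x \<otimes>\<^bsub>D\<^esub> x \<oplus>\<^bsub>D\<^esub> w \<otimes>\<^bsub>D\<^esub> w"
    using D.circle_point_exists[OF x le] .
  have mem: "x \<in> carrier D" "w \<in> carrier D"
    using x w by (auto simp: self_adjoint_def)
  have "h w \<otimes>\<^bsub>E\<^esub> h x = h x \<otimes>\<^bsub>E\<^esub> h w"
    using arg_cong[OF w(2), of h] mem by (simp add: hom_mult)
  moreover have "h w \<oplus>\<^bsub>E\<^esub> h w = h x \<otimes>\<^bsub>E\<^esub> h x \<oplus>\<^bsub>E\<^esub> h w \<otimes>\<^bsub>E\<^esub> h w"
    using arg_cong[OF w(3), of h] mem by (simp add: hom_mult hom_add)
  ultimately have "cnorm E (h x \<otimes>\<^bsub>E\<^esub> h x) \<le> cnorm E (h x)"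
    using E.norm_circle_mult_le[OF hom_self_adjoint[OF x] hom_self_adjoint[OF w(1)]] mem by simp
  moreover have "cnorm E (h x \<otimes>\<^bsub>E\<^esub> h x) = (cnorm E (h x))\<^sup>2"
    using E.cstar_identity[of "h x"] hom_self_adjoint[OF x] by (simp add: self_adjoint_def)
  ultimately show ?thesis
    using E.norm_nonneg[of "h x"] mem by (cases "cnorm E (h x) = 0") (auto simp: power2_eq_square)
qed

text \<open>In fact *-homomorphisms are contractive; boundedness is enough here.\<close>

lemma norm_hom_le:
  assumes x: "x \<in> carrier D"
  shows "cnorm E (h x) \<le> 2 * cnorm D x"
proof -
  have sa: "cnorm E (h y) \<le> 2 * cnorm D y" if y: "y \<in> self_adjoint D" for y
  proof (cases "y = \<zero>\<^bsub>D\<^esub>")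
    case False
    have yD: "y \<in> carrier D"
      using y by (simp add: self_adjoint_def)
    define t where "t = cnorm D y"
    have t: "t > 0"
      using D.norm_nonneg[OF yD] D.norm_eq_zero[OF yD] False by (simp add: t_def)
    \<comment> \<open>Rescaling to norm 1/2, the radius for which circle points were
      constructed.\<close>
    have "complex_of_real (1 / (2 * t)) \<odot>\<^bsub>D\<^esub> y \<in> self_adjoint D"
      using y by (rule D.self_adjoint_smult) simp
    moreover have "cnorm D (complex_of_real (1 / (2 * t)) \<odot>\<^bsub>D\<^esub> y) = 1 / 2"
      unfolding D.norm_smult[OF yD] norm_of_real using t by (simp add: t_def[symmetric])
    ultimately have "cnorm E (h (complex_of_real (1 / (2 * t)) \<odot>\<^bsub>D\<^esub> y)) \<le> 1"
      by (intro norm_hom_le_one) simp_all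
    then have "(1 / (2 * t)) * cnorm E (h y) \<le> 1"
      unfolding hom_smult[OF yD] E.norm_smult[OF hom_closed[OF yD]] norm_of_real using t by simp
    then show ?thesis
      using t by (simp add: t_def[symmetric] field_simps)
  qed simp
  \<comment> \<open>The C*-identity on both sides reduces a general \<open>x\<close> to the
    self-adjoint \<open>star D x \<otimes> x\<close>. The factor 2 obtained for the squares is
    relaxed to 4 to get 2 after the root.\<close>
  have "(cnorm E (h x))\<^sup>2 = cnorm E (h (star D x \<otimes>\<^bsub>D\<^esub> x))"
    using x by (simp add: hom_mult hom_star E.cstar_identity)
  also have "\<dots> \<le> 2 * cnorm D (star D x \<otimes>\<^bsub>D\<^esub> x)"
    using x by (intro sa) (simp add: self_adjoint_def D.star_mult D.star_star)
  also have "\<dots> = 2 * (cnorm D x)\<^sup>2"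
    using x by (simp add: D.cstar_identity)
  also have "\<dots> \<le> (2 * cnorm D x)\<^sup>2"
    by (simp add: power_mult_distrib)
  finally show ?thesis
    by (rule power2_le_imp_le) (simp add: D.norm_nonneg x)
qed

lemma norm_hom_minus_le:
  assumes "x \<in> carrier D" "y \<in> carrier D"
  shows "cnorm E (h x \<ominus>\<^bsub>E\<^esub> h y) \<le> 2 * cnorm D (x \<ominus>\<^bsub>D\<^esub> y)"
  using norm_hom_le[of "x \<ominus>\<^bsub>D\<^esub> y"] assms by (simp add: hom_minus)

lemma sub_cstar_vimage:
  assumes T: "sub_cstar_algebra T E"
  shows "sub_cstar_algebra {x \<in> carrier D. h x \<in> T} D"
proof -
  have "closedin (ctopology D) {x \<in> carrier D. h x \<in> T}"
    by (rule closedin_vimage_Lipschitz[OF D.normed_cmodule_axioms E.normed_cmodule_axioms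
          E.sub_cstarD(8)[OF T] hom_closed norm_hom_minus_le])
  then show ?thesis
    using E.sub_cstarD[OF T]
    by (auto simp: sub_cstar_algebra_def hom_add hom_smult hom_mult hom_star)
qed

text \<open>The preimage of \<open>T\<close> is a closed *-subalgebra containing \<open>X\<close>;
  its closedness is where boundedness of \<open>h\<close> enters.\<close>

lemma hom_generated:
  assumes "sub_cstar_algebra T E" "X \<subseteq> carrier D" "h ` X \<subseteq> T" "x \<in> generated_cstar D X"
  shows "h x \<in> T"
  using D.generated_least[OF sub_cstar_vimage[OF assms(1)], of X] assms by blast

end

section \<open>Openness of approximate generation, and closed subalgebras as C*-algebras\<close>

context cstar_algebra
begin

text \<open>The elements that stay approximable in this sense form a closed *-subalgebra containing all
  \<open>a j\<close>.\<close>

lemma generated_stable: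
  fixes a :: "nat \<Rightarrow> 'a"
  assumes a: "\<forall>j\<le>n. a j \<in> carrier A"
    and g: "g \<in> generated_cstar A (a ` {..n})" and "\<epsilon> > 0"
  obtains \<delta> where "\<delta> > 0"
    "\<And>b. (\<forall>j\<le>n. b j \<in> carrier A \<and> cnorm A (b j \<ominus> a j) < \<delta>)
      \<Longrightarrow> within_of A g \<epsilon> (generated_cstar A (b ` {..n}))"
proof -
  define near where "near \<delta> b \<longleftrightarrow> (\<forall>j\<le>n. b j \<in> carrier A \<and> cnorm A (b j \<ominus> a j) < \<delta>)"
    for \<delta> and b :: "nat \<Rightarrow> 'a"
  define C where "C b = generated_cstar A (b ` {..n})" for b :: "nat \<Rightarrow> 'a"
  have C: "sub_cstar_algebra (C b) A" if "near \<delta> b" for \<delta> b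
    using that unfolding C_def near_def by (intro sub_cstar_generated) auto
  have near_min: "near \<delta> b" "near \<delta>' b" if "near (min \<delta> \<delta>') b" for \<delta> \<delta>' b
    using that by (auto simp: near_def)
  \<comment> \<open>\<open>\<delta>\<close> may depend on \<open>g\<close> and
    \<open>\<epsilon>\<close> but has to work for all nearby tuples \<open>b\<close> at once; the
    approximating element of \<open>C b\<close> may vary with \<open>b\<close>.\<close>
  define G where "G = {g \<in> carrier A. \<forall>\<epsilon>>0. \<exists>\<delta>>0. \<forall>b. near \<delta> b \<longrightarrow> within_of A g \<epsilon> (C b)}"
  have GI: "g \<in> G" if "g \<in> carrier A" "\<And>\<epsilon>. \<epsilon> > 0 \<Longrightarrow> \<exists>\<delta>>0. \<forall>b. near \<delta> b \<longrightarrow> within_of A g \<epsilon> (C b)" for g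
    using that by (simp add: G_def)
  have GD: "\<exists>\<delta>>0. \<forall>b. near \<delta> b \<longrightarrow> within_of A g \<epsilon> (C b)" if "g \<in> G" "\<epsilon> > 0" for g \<epsilon>
    using that by (simp add: G_def)
  have GA: "g \<in> carrier A" if "g \<in> G" for g
    using that by (simp add: G_def)
  have GD2: "\<exists>\<delta>>0. \<forall>b. near \<delta> b \<longrightarrow> within_of A x \<epsilon> (C b) \<and> within_of A y \<epsilon> (C b)"
    if "x \<in> G" "y \<in> G" "\<epsilon> > 0" for x y \<epsilon>
  proof -
    from GD[OF that(1,3)] GD[OF that(2,3)] obtain \<delta> \<delta>' where
      "\<delta> > 0" "\<forall>b. near \<delta> b \<longrightarrow> within_of A x \<epsilon> (C b)" "\<delta>' > 0" "\<forall>b. near \<delta>' b \<longrightarrow> within_of A y \<epsilon> (C b)"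
      by blast
    then have "\<forall>b. near (min \<delta> \<delta>') b \<longrightarrow> within_of A x \<epsilon> (C b) \<and> within_of A y \<epsilon> (C b)" "min \<delta> \<delta>' > 0"
      using near_min[of \<delta> \<delta>'] by (blast, simp)
    then show ?thesis
      by blast
  qed
  have add: "x \<oplus> y \<in> G" if xy: "x \<in> G" "y \<in> G" for x y
  proof (rule GI)
    fix \<epsilon> :: real assume "\<epsilon> > 0"
    then obtain \<delta> where \<delta>: "\<delta> > 0" "\<And>b. near \<delta> b \<Longrightarrow> within_of A x (\<epsilon>/2) (C b) \<and> within_of A y (\<epsilon>/2) (C b)"
      using GD2[OF xy, of "\<epsilon>/2"] by auto
    have "within_of A (x \<oplus> y) \<epsilon> (C b)" if b: "near \<delta> b" for b
    proof -
      obtain x' y' where x': "x' \<in> C b" "cnorm A (x \<ominus> x') < \<epsilon>/2" and y': "y' \<in> C b" "cnorm A (y \<ominus> y') < \<epsilon>/2"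
        using \<delta>(2)[OF b] by (auto simp: within_of_def)
      have "cnorm A ((x \<oplus> y) \<ominus> (x' \<oplus> y')) < \<epsilon>"
        using norm_add_minus_add[of x y x' y'] x' y' GA xy sub_cstarD(2)[OF C[OF b]] by fastforce
      then show ?thesis
        using x' y' sub_cstarD(4)[OF C[OF b]] by (auto simp: within_of_def)
    qed
    then show "\<exists>\<delta>>0. \<forall>b. near \<delta> b \<longrightarrow> within_of A (x \<oplus> y) \<epsilon> (C b)"
      using \<delta> by blast
  qed (use xy GA in simp)
  have mult: "x \<otimes> y \<in> G" if xy: "x \<in> G" "y \<in> G" for x y
  proof (rule GI)
    fix \<epsilon> :: real assume \<epsilon>: "\<epsilon> > 0"
    \<comment> \<open>The error of a product is below
      \<open>cnorm A x * \<eta> + \<eta> * (cnorm A y + 1) = \<eta> * K\<close>; the bound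
      \<open>\<eta> \<le> 1\<close> is what gives
      \<open>cnorm A y' \<le> cnorm A y + 1\<close>.\<close>
    define K where "K = cnorm A x + cnorm A y + 1"
    have K: "K > 0"
      using norm_nonneg GA xy unfolding K_def by (simp add: add_nonneg_pos)
    define \<eta> where "\<eta> = min 1 (\<epsilon> / K)"
    have \<eta>: "\<eta> > 0" "\<eta> \<le> 1" "\<eta> * K \<le> \<epsilon>"
      using \<epsilon> K mult_right_mono[of \<eta> "\<epsilon> / K" K] by (simp_all add: \<eta>_def)
    obtain \<delta> where \<delta>: "\<delta> > 0" "\<And>b. near \<delta> b \<Longrightarrow> within_of A x \<eta> (C b) \<and> within_of A y \<eta> (C b)"
      using GD2[OF xy, of \<eta>] \<eta> by auto
    have "within_of A (x \<otimes> y) \<epsilon> (C b)" if b: "near \<delta> b" for b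
    proof -
      obtain x' y' where x': "x' \<in> C b" "cnorm A (x \<ominus> x') < \<eta>" and y': "y' \<in> C b" "cnorm A (y \<ominus> y') < \<eta>"
        using \<delta>(2)[OF b] by (auto simp: within_of_def)
      have mem: "x \<in> carrier A" "y \<in> carrier A" "x' \<in> carrier A" "y' \<in> carrier A"
        using x' y' GA xy sub_cstarD(2)[OF C[OF b]] by auto
      have ny: "cnorm A y' \<le> cnorm A y + 1"
        using norm_le_minus[of y' y] norm_minus_commute[of y y'] y' \<eta> mem by simp
      have "cnorm A ((x \<otimes> y) \<ominus> (x' \<otimes> y'))
          \<le> cnorm A x * cnorm A (y \<ominus> y') + cnorm A (x \<ominus> x') * cnorm A y'"
        using norm_mult_minus_mult mem by blast
      also have "\<dots> \<le> cnorm A x * \<eta> + cnorm A (x \<ominus> x') * (cnorm A y + 1)"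
        using ny y' mem norm_nonneg by (intro add_mono mult_left_mono) auto
      also have "\<dots> < cnorm A x * \<eta> + \<eta> * (cnorm A y + 1)"
        using x' mem norm_nonneg by (intro add_strict_left_mono mult_strict_right_mono) (auto simp: add_nonneg_pos)
      also have "\<dots> = \<eta> * K"
        by (simp add: K_def algebra_simps)
      finally have "cnorm A ((x \<otimes> y) \<ominus> (x' \<otimes> y')) < \<epsilon>"
        using \<eta> by simp
      then show ?thesis
        using x' y' sub_cstarD(6)[OF C[OF b]] by (auto simp: within_of_def)
    qed
    then show "\<exists>\<delta>>0. \<forall>b. near \<delta> b \<longrightarrow> within_of A (x \<otimes> y) \<epsilon> (C b)"
      using \<delta> by blast
  qed (use xy GA in simp)
  have smult: "\<alpha> \<odot> x \<in> G" if x: "x \<in> G" for \<alpha> x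
  proof (rule GI)
    fix \<epsilon> :: real assume \<epsilon>: "\<epsilon> > 0"
    have pos: "cmod \<alpha> + 1 > 0"
      by (simp add: add_nonneg_pos)
    then obtain \<delta> where \<delta>: "\<delta> > 0" "\<And>b. near \<delta> b \<Longrightarrow> within_of A x (\<epsilon> / (cmod \<alpha> + 1)) (C b)"
      using GD[OF x, of "\<epsilon> / (cmod \<alpha> + 1)"] \<epsilon> by auto
    have "within_of A (\<alpha> \<odot> x) \<epsilon> (C b)" if b: "near \<delta> b" for b
    proof -
      obtain x' where x': "x' \<in> C b" "cnorm A (x \<ominus> x') < \<epsilon> / (cmod \<alpha> + 1)"
        using \<delta>(2)[OF b] by (auto simp: within_of_def)
      have mem: "x \<in> carrier A" "x' \<in> carrier A"
        using x' GA x sub_cstarD(2)[OF C[OF b]] by auto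
      have "cnorm A (\<alpha> \<odot> x \<ominus> \<alpha> \<odot> x') = cmod \<alpha> * cnorm A (x \<ominus> x')"
        using mem by (simp add: smult_diff[symmetric] norm_smult)
      also have "\<dots> \<le> (cmod \<alpha> + 1) * cnorm A (x \<ominus> x')"
        using mem norm_nonneg by (intro mult_right_mono) auto
      also have "\<dots> < \<epsilon>"
        using x' pos by (simp add: field_simps)
      finally show ?thesis
        using x' sub_cstarD(5)[OF C[OF b]] by (auto simp: within_of_def)
    qed
    then show "\<exists>\<delta>>0. \<forall>b. near \<delta> b \<longrightarrow> within_of A (\<alpha> \<odot> x) \<epsilon> (C b)"
      using \<delta> by blast
  qed (use x GA in simp)
  have star: "star A x \<in> G" if x: "x \<in> G" for x
  proof (rule GI)
    fix \<epsilon> :: real assume \<epsilon>: "\<epsilon> > 0"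
    then obtain \<delta> where \<delta>: "\<delta> > 0" "\<And>b. near \<delta> b \<Longrightarrow> within_of A x \<epsilon> (C b)"
      using GD[OF x] by auto
    have "within_of A (star A x) \<epsilon> (C b)" if b: "near \<delta> b" for b
    proof -
      obtain x' where x': "x' \<in> C b" "cnorm A (x \<ominus> x') < \<epsilon>"
        using \<delta>(2)[OF b] by (auto simp: within_of_def)
      then have "cnorm A (star A x \<ominus> star A x') < \<epsilon>"
        using GA x sub_cstarD(2)[OF C[OF b]] by (simp add: star_minus[symmetric])
      then show ?thesis
        using x' sub_cstarD(7)[OF C[OF b]] by (auto simp: within_of_def)
    qed
    then show "\<exists>\<delta>>0. \<forall>b. near \<delta> b \<longrightarrow> within_of A (star A x) \<epsilon> (C b)"
      using \<delta> by blast
  qed (use x GA in simp)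
  have closed: "closedin (ctopology A) G"
    unfolding closedin_iff
  proof (intro conjI ballI impI)
    fix x assume x: "x \<in> carrier A" and lim: "\<forall>\<epsilon>>0. within_of A x \<epsilon> G"
    show "x \<in> G"
    proof (rule GI[OF x])
      fix \<epsilon> :: real assume \<epsilon>: "\<epsilon> > 0"
      then obtain g where g: "g \<in> G" "cnorm A (x \<ominus> g) < \<epsilon>/2"
        using lim half_gt_zero[OF \<epsilon>] unfolding within_of_def by blast
      obtain \<delta> where \<delta>: "\<delta> > 0" "\<And>b. near \<delta> b \<Longrightarrow> within_of A g (\<epsilon>/2) (C b)"
        using GD[OF g(1), of "\<epsilon>/2"] \<epsilon> by auto
      have "within_of A x (\<epsilon>/2 + \<epsilon>/2) (C b)" if b: "near \<delta> b" for b
        using within_of_triangle[OF \<delta>(2)[OF b] sub_cstarD(1)[OF C[OF b]] GA[OF g(1)] x, of "\<epsilon>/2"] g by simp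
      then show "\<exists>\<delta>>0. \<forall>b. near \<delta> b \<longrightarrow> within_of A x \<epsilon> (C b)"
        using \<delta> by auto
    qed
  qed (use GA in blast)
  have zero: "\<zero> \<in> G"
  proof (rule GI)
    fix \<epsilon> :: real assume "\<epsilon> > 0"
    then show "\<exists>\<delta>>0. \<forall>b. near \<delta> b \<longrightarrow> within_of A \<zero> \<epsilon> (C b)"
      using sub_cstarD(3)[OF C] by (intro exI[of _ \<epsilon>]) (force simp: within_of_def)
  qed simp
  have gens: "a ` {..n} \<subseteq> G"
  proof safe
    fix j assume j: "j \<le> n"
    show "a j \<in> G"
    proof (rule GI)
      fix \<epsilon> :: real assume "\<epsilon> > 0"
      moreover have "within_of A (a j) \<epsilon> (C b)" if b: "near \<epsilon> b" for b
      proof -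
        have "b j \<in> C b"
          using sub_generated[of "b ` {..n}"] j by (auto simp: C_def)
        moreover have "cnorm A (a j \<ominus> b j) < \<epsilon>"
          using b j a norm_minus_commute[of "a j" "b j"] by (simp add: near_def)
        ultimately show ?thesis
          by (auto simp: within_of_def)
      qed
      ultimately show "\<exists>\<delta>>0. \<forall>b. near \<delta> b \<longrightarrow> within_of A (a j) \<epsilon> (C b)"
        by blast
    qed (use a j in blast)
  qed
  have "sub_cstar_algebra G A"
    unfolding sub_cstar_algebra_def
    by (intro conjI ballI allI subsetI GA zero add mult smult star closed)
  then have "g \<in> G"
    using generated_least[OF _ gens] g by blast
  then show ?thesis
    using GD \<open>\<epsilon> > 0\<close> that unfolding near_def C_def by blast
qed

text \<open>Completeness is the axiom not inherited pointwise: a Cauchy sequence converges in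
  \<open>A\<close>, and closedness puts its limit into \<open>S\<close>.\<close>

lemma cstar_algebra_subalg:
  assumes S: "sub_cstar_algebra S A"
  shows "cstar_algebra (A\<lparr>carrier := S\<rparr>)"
proof -
  let ?S = "A\<lparr>carrier := S\<rparr>"
  note SD = sub_cstarD[OF S]
  have ag: "abelian_group ?S"
  proof (rule abelian_groupI)
    fix x assume "x \<in> carrier ?S"
    then show "\<exists>y\<in>carrier ?S. y \<oplus>\<^bsub>?S\<^esub> x = \<zero>\<^bsub>?S\<^esub>"
      using SD(2)[of x] SD(5)[of x "-1"] M.l_neg[of x] by auto
  qed (use SD in \<open>auto simp: M.a_ac\<close>)
  have "Module.module complex_ring ?S"
    using SD by (intro moduleI cring_complex_ring ag) (auto simp: smult_add smult_distr)
  note mod = this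
  interpret S: normed_cmodule ?S
    using SD by (intro normed_cmodule.intro normed_cmodule_axioms.intro mod)
      (auto simp: norm_nonneg norm_eq_zero norm_triangle norm_smult)
  \<comment> \<open>Negation is defined relative to the carrier, so subtraction in \<open>?S\<close>
    must be identified with that in \<open>A\<close>; both negations are multiplication by
    -1.\<close>
  have minus [simp]: "x \<ominus>\<^bsub>?S\<^esub> y = x \<ominus> y" if "x \<in> S" "y \<in> S" for x y
    using S.smult_simps(6)[of y] SD(2) that by (simp add: M.minus_eq S.M.minus_eq)
  have "S.metric.mcomplete"
    unfolding S.mcomplete_iff
  proof (intro allI impI, elim conjE)
    fix \<sigma> :: "nat \<Rightarrow> _"
    assume \<sigma>: "\<forall>n. \<sigma> n \<in> carrier ?S"
      and C: "\<forall>\<epsilon>>0. \<exists>N. \<forall>m\<ge>N. \<forall>n\<ge>N. cnorm ?S (\<sigma> m \<ominus>\<^bsub>?S\<^esub> \<sigma> n) < \<epsilon>"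
    obtain x where x: "x \<in> carrier A" "\<forall>\<epsilon>>0. \<exists>N. \<forall>n\<ge>N. cnorm A (\<sigma> n \<ominus> x) < \<epsilon>"
      using complete[unfolded mcomplete_iff, rule_format, of \<sigma>] \<sigma> C SD(2) by auto
    have "x \<in> S"
    proof (rule closedinD[OF SD(8) x(1)])
      fix \<epsilon> :: real assume "\<epsilon> > 0"
      then obtain N where "cnorm A (\<sigma> N \<ominus> x) < \<epsilon>"
        using x(2) by blast
      then show "within_of A x \<epsilon> S"
        using \<sigma> SD(2) norm_minus_commute[OF x(1), of "\<sigma> N"]
        unfolding within_of_def by (intro bexI[of _ "\<sigma> N"]) auto
    qed
    then show "\<exists>x\<in>carrier ?S. \<forall>\<epsilon>>0. \<exists>N. \<forall>n\<ge>N. cnorm ?S (\<sigma> n \<ominus>\<^bsub>?S\<^esub> x) < \<epsilon>"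
      using x(2) \<sigma> by (intro bexI[of _ x]) auto
  qed
  then show ?thesis
    using SD
    by (intro cstar_algebra.intro cstar_algebra_axioms.intro mod)
      (auto simp: mult_assoc mult_l_distr mult_r_distr smult_mult_left smult_mult_right star_star
        star_add star_smult star_mult norm_nonneg norm_eq_zero norm_triangle norm_smult norm_mult
        cstar_identity)
qed

end

section \<open>The minimal unitization\<close>

locale nonunital_cstar_algebra = cstar_algebra A for A :: "'a cstar" (structure) +
  assumes nonunital: "\<not> unital A"
begin

abbreviation "U \<equiv> unitization A"

text \<open>The representation of the unitization on its ideal \<open>A\<close> by left
  multiplication; \<open>cnorm U\<close> is the operator norm of \<open>act u\<close>, so norm laws
  for \<open>U\<close> are proved on vectors \<open>b\<close>.\<close>

definition act :: "'a \<times> complex \<Rightarrow> 'a \<Rightarrow> 'a" where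
  "act u b = fst u \<otimes> b \<oplus> snd u \<odot> b"

lemma unitization_simps [simp]:
  "carrier U = carrier A \<times> UNIV"
  "(a, \<alpha>) \<otimes>\<^bsub>U\<^esub> (b, \<beta>) = (a \<otimes> b \<oplus> \<alpha> \<odot> b \<oplus> \<beta> \<odot> a, \<alpha> * \<beta>)"
  "\<zero>\<^bsub>U\<^esub> = (\<zero>, 0)"
  "(a, \<alpha>) \<oplus>\<^bsub>U\<^esub> (b, \<beta>) = (a \<oplus> b, \<alpha> + \<beta>)"
  "\<gamma> \<odot>\<^bsub>U\<^esub> (a, \<alpha>) = (\<gamma> \<odot> a, \<gamma> * \<alpha>)"
  "star U (a, \<alpha>) = (star A a, cnj \<alpha>)"
  by (simp_all add: unitization_def)

lemma norm_unitization:
  "cnorm U u = (SUP b\<in>{b \<in> carrier A. cnorm A b \<le> 1}. cnorm A (act u b))"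
  by (cases u) (simp add: unitization_def act_def)

lemma act_closed [simp]: "u \<in> carrier U \<Longrightarrow> b \<in> carrier A \<Longrightarrow> act u b \<in> carrier A"
  by (auto simp: act_def)

lemma act_smult: "u \<in> carrier U \<Longrightarrow> b \<in> carrier A \<Longrightarrow> act u (\<gamma> \<odot> b) = \<gamma> \<odot> act u b"
  by (auto simp: act_def smult_mult_right smult_distr mult.commute)

lemma act_add: "\<lbrakk>u \<in> carrier U; v \<in> carrier U; b \<in> carrier A\<rbrakk>
    \<Longrightarrow> act (u \<oplus>\<^bsub>U\<^esub> v) b = act u b \<oplus> act v b"
  by (auto simp: act_def mult_l_distr smult_add M.a_ac)

lemma act_smult_left: "u \<in> carrier U \<Longrightarrow> b \<in> carrier A \<Longrightarrow> act (\<gamma> \<odot>\<^bsub>U\<^esub> u) b = \<gamma> \<odot> act u b"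
  by (auto simp: act_def smult_mult_left smult_distr)

lemma act_mult: "\<lbrakk>u \<in> carrier U; v \<in> carrier U; b \<in> carrier A\<rbrakk>
    \<Longrightarrow> act (u \<otimes>\<^bsub>U\<^esub> v) b = act u (act v b)"
  by (auto simp: act_def mult_l_distr mult_r_distr smult_mult_left smult_mult_right smult_distr
      mult_assoc M.a_ac)

text \<open>\<open>act (star U u)\<close> is the adjoint of \<open>act u\<close> for the
  \<open>A\<close>-valued inner product \<open>star A b \<otimes> c\<close>; this carries the
  C*-identity from \<open>A\<close> to the unitization.\<close>

lemma star_act_mult: "\<lbrakk>u \<in> carrier U; b \<in> carrier A; c \<in> carrier A\<rbrakk>
    \<Longrightarrow> star A (act u b) \<otimes> c = star A b \<otimes> act (star U u) c"
  by (auto simp: act_def star_add star_mult star_smult mult_l_distr mult_r_distr smult_mult_left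
      smult_mult_right mult_assoc)

lemma norm_act_le_sum:
  assumes "u \<in> carrier U" "b \<in> carrier A"
  shows "cnorm A (act u b) \<le> (cnorm A (fst u) + cmod (snd u)) * cnorm A b"
  using norm_triangle[of "fst u \<otimes> b" "snd u \<odot> b"] norm_mult[of "fst u" b] assms
  by (auto simp: act_def norm_smult distrib_right)

lemma norm_act_le:
  assumes u: "u \<in> carrier U" and b: "b \<in> carrier A"
  shows "cnorm A (act u b) \<le> cnorm U u * cnorm A b"
proof -
  \<comment> \<open>A real supremum dominates its members only over a bounded set, so boundedness on
    the unit ball precedes any use of the norm.\<close>
  have bdd: "bdd_above ((\<lambda>b. cnorm A (act u b)) ` {b \<in> carrier A. cnorm A b \<le> 1})"
  proof (rule bdd_aboveI2)
    fix b assume b: "b \<in> {b \<in> carrier A. cnorm A b \<le> 1}"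
    have "cnorm A (act u b) \<le> (cnorm A (fst u) + cmod (snd u)) * cnorm A b"
      using norm_act_le_sum[OF u] b by blast
    also have "\<dots> \<le> (cnorm A (fst u) + cmod (snd u)) * 1"
      using b u by (intro mult_left_mono) (auto simp: norm_nonneg)
    finally show "cnorm A (act u b) \<le> cnorm A (fst u) + cmod (snd u)"
      by simp
  qed
  show ?thesis
  proof (cases "b = \<zero>")
    case True
    have "act u \<zero> = \<zero>"
      using u by (auto simp: act_def)
    then show ?thesis
      using True by simp
  next
    case False
    define t where "t = cnorm A b"
    have t: "t > 0"
      using False norm_nonneg[OF b] norm_eq_zero[OF b] by (simp add: t_def)
    define b' where "b' = complex_of_real (1 / t) \<odot> b"
    have "cnorm A b' = 1"
      unfolding b'_def norm_smult[OF b] norm_of_real using t by (simp add: t_def[symmetric])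
    then have "cnorm A (act u b') \<le> cnorm U u"
      unfolding norm_unitization using b by (intro cSUP_upper bdd) (simp add: b'_def)
    moreover have "cnorm A (act u b') = (1 / t) * cnorm A (act u b)"
      unfolding b'_def act_smult[OF u b] norm_smult[OF act_closed[OF u b]] norm_of_real
      using t by simp
    ultimately show ?thesis
      using t by (simp add: t_def[symmetric] field_simps)
  qed
qed

lemma norm_unitization_least:
  assumes "K \<ge> 0" and le: "\<And>b. b \<in> carrier A \<Longrightarrow> cnorm A (act u b) \<le> K * cnorm A b"
  shows "cnorm U u \<le> K"
  unfolding norm_unitization
proof (rule cSUP_least)
  fix b assume "b \<in> {b \<in> carrier A. cnorm A b \<le> 1}"
  then show "cnorm A (act u b) \<le> K"
    using le[of b] mult_left_mono[of "cnorm A b" 1 K] \<open>K \<ge> 0\<close> by simp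
next
  have "\<zero> \<in> {b \<in> carrier A. cnorm A b \<le> 1}"
    by simp
  then show "{b \<in> carrier A. cnorm A b \<le> 1} \<noteq> {}"
    by blast
qed

lemma norm_unitization_le: "u \<in> carrier U \<Longrightarrow> cnorm U u \<le> cnorm A (fst u) + cmod (snd u)"
  by (intro norm_unitization_least norm_act_le_sum) (auto simp: norm_nonneg)

lemma norm_unitization_nonneg:
  assumes "u \<in> carrier U"
  shows "0 \<le> cnorm U u"
proof -
  \<comment> \<open>The zero algebra is unital, with unit \<open>\<zero>\<close>, so
    \<open>A\<close> has a nonzero element; applied to it, \<open>norm_act_le\<close> forces the
    factor \<open>cnorm U u\<close> to be nonnegative.\<close>
  have "\<exists>b\<in>carrier A. b \<noteq> \<zero>"
  proof (rule ccontr)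
    assume "\<not> ?thesis"
    then have "unital A"
      by (auto simp: unital_def intro!: bexI[of _ \<zero>])
    with nonunital show False ..
  qed
  then obtain b where b: "b \<in> carrier A" "cnorm A b > 0"
    using norm_nonneg norm_eq_zero by (metis order.not_eq_order_implies_strict)
  then show ?thesis
    using norm_act_le[OF assms b(1)] norm_nonneg[OF act_closed[OF assms b(1)]]
    by (metis order_trans zero_le_mult_iff linorder_not_less)
qed

text \<open>Otherwise \<open>1 - x\<close> with \<open>x = -a/\<alpha>\<close> is a strict contraction of \<open>A\<close>, which yields a unit.\<close>

lemma norm_scalar_le:
  assumes u: "u \<in> carrier U"
  shows "cmod (snd u) \<le> cnorm U u"
proof (rule ccontr)
  assume "\<not> ?thesis"
  then have less: "cnorm U u < cmod (snd u)"
    by simp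
  define a \<alpha> where "a = fst u" and "\<alpha> = snd u"
  have a: "a \<in> carrier A"
    using u by (auto simp: a_def)
  have \<alpha>: "\<alpha> \<noteq> 0"
    using less norm_unitization_nonneg[OF u] by (auto simp: \<alpha>_def)
  define x where "x = (- 1 / \<alpha>) \<odot> a"
  have x: "x \<in> carrier A"
    using a by (simp add: x_def)
  define k where "k = cnorm U u / cmod \<alpha>"
  have "k < 1"
    using less \<alpha> by (simp add: k_def \<alpha>_def)
  have near: "cnorm A (b \<ominus> x \<otimes> b) \<le> k * cnorm A b" if b: "b \<in> carrier A" for b
  proof -
    have "b \<ominus> x \<otimes> b = (1 / \<alpha>) \<odot> act u b"
      using a b \<alpha> smult_minus[of "a \<otimes> b" "1 / \<alpha>"]
      by (simp add: act_def a_def[symmetric] \<alpha>_def[symmetric] x_def smult_mult_left smult_distr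
          M.minus_eq M.a_comm)
    then have "cnorm A (b \<ominus> x \<otimes> b) = (1 / cmod \<alpha>) * cnorm A (act u b)"
      using u b by (simp add: norm_smult norm_divide)
    also have "\<dots> \<le> (1 / cmod \<alpha>) * (cnorm U u * cnorm A b)"
      using norm_act_le[OF u b] by (intro mult_left_mono) auto
    finally show ?thesis
      by (simp add: k_def)
  qed
  obtain s where s: "s \<in> carrier A" "\<And>b. b \<in> carrier A \<Longrightarrow> s \<otimes> b = b"
    using left_unit_of_near[OF sub_cstar_carrier x \<open>k < 1\<close> near] by blast
  \<comment> \<open>Taking adjoints turns the left unit \<open>s\<close> into a right unit
    \<open>star A s\<close>; the product \<open>s \<otimes> star A s\<close> then equals both, so
    \<open>s\<close> is a two-sided unit.\<close>
  have right: "b \<otimes> star A s = b" if b: "b \<in> carrier A" for b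
    using s b star_mult[of s "star A b"] by (simp add: star_star)
  have "star A s = s"
    using s right[OF s(1)] by (metis star_closed)
  then have "unital A"
    using s right unfolding unital_def by metis
  with nonunital show False ..
qed

text \<open>From \<open>a a* = u a* - \<alpha> a*\<close> and the bound on \<open>\<alpha>\<close>,
  dividing by the norm of \<open>a\<close>. With \<open>norm_scalar_le\<close> both coordinates are
  controlled by \<open>cnorm U\<close>, which yields definiteness and completeness.\<close>

lemma norm_vector_le:
  assumes u: "u \<in> carrier U"
  shows "cnorm A (fst u) \<le> 2 * cnorm U u"
proof (cases "cnorm A (fst u) = 0")
  case False
  define a \<alpha> where "a = fst u" and "\<alpha> = snd u"
  have a: "a \<in> carrier A"
    using u by (auto simp: a_def)
  have "a \<otimes> star A a = act u (star A a) \<ominus> \<alpha> \<odot> star A a"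
    using a unfolding act_def a_def[symmetric] \<alpha>_def[symmetric]
    by (simp add: M.minus_eq M.a_assoc M.r_neg)
  then have "cnorm A (a \<otimes> star A a) \<le> cnorm A (act u (star A a)) + cmod \<alpha> * cnorm A a"
    using norm_minus_le[of "act u (star A a)" "\<alpha> \<odot> star A a"] a u by (simp add: norm_smult)
  also have "\<dots> \<le> cnorm U u * cnorm A a + cnorm U u * cnorm A a"
    using norm_act_le[OF u, of "star A a"] norm_scalar_le[OF u] a
    by (intro add_mono mult_right_mono) (auto simp: \<alpha>_def norm_nonneg)
  finally have "cnorm A a * cnorm A a \<le> (2 * cnorm U u) * cnorm A a"
    using cstar_identity[of "star A a"] a by (simp add: star_star power2_eq_square mult_ac)
  moreover have "cnorm A a > 0"
    using False norm_nonneg[OF a] by (simp add: a_def)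
  ultimately show ?thesis
    unfolding a_def by simp
qed (use norm_unitization_nonneg[OF u] in simp)

lemma norm_unitization_mult:
  assumes u: "u \<in> carrier U" and v: "v \<in> carrier U"
  shows "cnorm U (u \<otimes>\<^bsub>U\<^esub> v) \<le> cnorm U u * cnorm U v"
proof (rule norm_unitization_least)
  fix b assume b: "b \<in> carrier A"
  have "cnorm A (act (u \<otimes>\<^bsub>U\<^esub> v) b) = cnorm A (act u (act v b))"
    using act_mult[OF u v b] by simp
  also have "\<dots> \<le> cnorm U u * cnorm A (act v b)"
    by (rule norm_act_le[OF u act_closed[OF v b]])
  also have "\<dots> \<le> cnorm U u * (cnorm U v * cnorm A b)"
    by (rule mult_left_mono[OF norm_act_le[OF v b] norm_unitization_nonneg[OF u]])
  finally show "cnorm A (act (u \<otimes>\<^bsub>U\<^esub> v) b) \<le> cnorm U u * cnorm U v * cnorm A b"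
    by (simp add: mult.assoc)
qed (intro mult_nonneg_nonneg norm_unitization_nonneg u v)

text \<open>For each vector \<open>b\<close> the square of the norm of \<open>u b\<close> is the
  norm of \<open>b* (u* u b)\<close>, at most that of \<open>u* u\<close> times the squared norm of
  \<open>b\<close>. This half of the C*-identity already forces the involution to be isometric,
  which in turn gives the other half.\<close>

lemma norm_unitization_square_le:
  assumes u: "u \<in> carrier U"
  shows "(cnorm U u)\<^sup>2 \<le> cnorm U (star U u \<otimes>\<^bsub>U\<^esub> u)"
proof -
  have su: "star U u \<in> carrier U" "star U u \<otimes>\<^bsub>U\<^esub> u \<in> carrier U"
    using u by auto
  let ?N = "cnorm U (star U u \<otimes>\<^bsub>U\<^esub> u)"
  have N: "?N \<ge> 0"
    by (rule norm_unitization_nonneg[OF su(2)])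
  have "cnorm U u \<le> sqrt ?N"
  proof (rule norm_unitization_least)
    fix b assume b: "b \<in> carrier A"
    have "(cnorm A (act u b))\<^sup>2 = cnorm A (star A b \<otimes> act (star U u \<otimes>\<^bsub>U\<^esub> u) b)"
      using u b su by (simp add: cstar_identity[symmetric] star_act_mult act_mult)
    also have "\<dots> \<le> cnorm A b * cnorm A (act (star U u \<otimes>\<^bsub>U\<^esub> u) b)"
      using norm_mult[of "star A b" "act (star U u \<otimes>\<^bsub>U\<^esub> u) b"] b act_closed[OF su(2) b] by simp
    also have "\<dots> \<le> cnorm A b * (?N * cnorm A b)"
      by (rule mult_left_mono[OF norm_act_le[OF su(2) b] norm_nonneg[OF b]])
    finally have "(cnorm A (act u b))\<^sup>2 \<le> (sqrt ?N * cnorm A b)\<^sup>2"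
      using N by (simp add: power_mult_distrib power2_eq_square mult_ac)
    then show "cnorm A (act u b) \<le> sqrt ?N * cnorm A b"
      by (rule power2_le_imp_le) (simp add: N norm_nonneg b)
  qed (simp add: N)
  then have "(cnorm U u)\<^sup>2 \<le> (sqrt ?N)\<^sup>2"
    by (rule power_mono) (rule norm_unitization_nonneg[OF u])
  then show ?thesis
    using N by simp
qed

lemma norm_unitization_star:
  assumes u: "u \<in> carrier U"
  shows "cnorm U (star U u \<otimes>\<^bsub>U\<^esub> u) = (cnorm U u)\<^sup>2"
proof -
  have le: "cnorm U v \<le> cnorm U (star U v)" if v: "v \<in> carrier U" for v
  proof (cases "cnorm U v = 0")
    case True
    then show ?thesis
      using v norm_unitization_nonneg[of "star U v"] by auto
  next
    case False
    have "star U v \<in> carrier U"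
      using v by auto
    then have "cnorm U v * cnorm U v \<le> cnorm U (star U v) * cnorm U v"
      using norm_unitization_square_le[OF v] norm_unitization_mult[of "star U v" v] v
      by (simp add: power2_eq_square)
    then show ?thesis
      using False norm_unitization_nonneg[OF v] by simp
  qed
  have su: "star U u \<in> carrier U" "star U (star U u) = u"
    using u by (auto simp: star_star)
  have "cnorm U (star U u) = cnorm U u"
    using le[OF u] le[OF su(1)] su by simp
  then show ?thesis
    using norm_unitization_square_le[OF u] norm_unitization_mult[OF su(1) u]
    by (simp add: power2_eq_square)
qed

section \<open>The unitization satisfies the C*-axioms\<close>

lemma abelian_group_unitization: "abelian_group U"
proof (rule abelian_groupI)
  fix u assume "u \<in> carrier U"
  then show "\<exists>v\<in>carrier U. v \<oplus>\<^bsub>U\<^esub> u = \<zero>\<^bsub>U\<^esub>"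
    by (intro bexI[of _ "(\<ominus> fst u, - snd u)"]) (auto simp: M.l_neg)
qed (auto simp: M.a_ac)

lemma module_unitization: "Module.module complex_ring U"
  by (intro moduleI cring_complex_ring abelian_group_unitization)
    (auto simp: smult_add smult_distr algebra_simps)

lemma normed_cmodule_unitization: "normed_cmodule U"
proof (intro normed_cmodule.intro module_unitization normed_cmodule_axioms.intro)
  fix u assume u: "u \<in> carrier U"
  show "0 \<le> cnorm U u"
    by (rule norm_unitization_nonneg[OF u])
  show "cnorm U u = 0 \<longleftrightarrow> u = \<zero>\<^bsub>U\<^esub>"
  proof
    assume "cnorm U u = 0"
    then show "u = \<zero>\<^bsub>U\<^esub>"
      using norm_scalar_le[OF u] norm_vector_le[OF u] norm_nonneg[of "fst u"] u
      by (auto simp: norm_eq_zero[symmetric])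
  next
    assume "u = \<zero>\<^bsub>U\<^esub>"
    then show "cnorm U u = 0"
      using norm_unitization_le[OF u] norm_unitization_nonneg[OF u] by simp
  qed
  have le: "cnorm U (\<beta> \<odot>\<^bsub>U\<^esub> v) \<le> cmod \<beta> * cnorm U v" if v: "v \<in> carrier U" for \<beta> v
    using norm_act_le[OF v]
    by (intro norm_unitization_least) (auto simp: act_smult_left[OF v] act_closed[OF v]
        norm_smult norm_unitization_nonneg[OF v] mult.assoc intro!: mult_left_mono)
  show "cnorm U (\<alpha> \<odot>\<^bsub>U\<^esub> u) = cmod \<alpha> * cnorm U u" for \<alpha>
  proof (cases "\<alpha> = 0")
    case True
    then have "\<alpha> \<odot>\<^bsub>U\<^esub> u = \<zero>\<^bsub>U\<^esub>" "\<zero>\<^bsub>U\<^esub> \<in> carrier U"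
      using u by auto
    then show ?thesis
      using True norm_unitization_le[of "\<zero>\<^bsub>U\<^esub>"] norm_unitization_nonneg[of "\<zero>\<^bsub>U\<^esub>"] by simp
  next
    case False
    have "u = (1 / \<alpha>) \<odot>\<^bsub>U\<^esub> (\<alpha> \<odot>\<^bsub>U\<^esub> u)"
      using u False by auto
    then have "cnorm U u \<le> (1 / cmod \<alpha>) * cnorm U (\<alpha> \<odot>\<^bsub>U\<^esub> u)"
      using le[of "\<alpha> \<odot>\<^bsub>U\<^esub> u" "1 / \<alpha>"] u by (auto simp: norm_divide)
    then show ?thesis
      using le[OF u, of \<alpha>] False by (simp add: field_simps)
  qed
  fix v assume v: "v \<in> carrier U"
  show "cnorm U (u \<oplus>\<^bsub>U\<^esub> v) \<le> cnorm U u + cnorm U v"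
  proof (rule norm_unitization_least)
    fix b assume b: "b \<in> carrier A"
    show "cnorm A (act (u \<oplus>\<^bsub>U\<^esub> v) b) \<le> (cnorm U u + cnorm U v) * cnorm A b"
      using norm_triangle[of "act u b" "act v b"] norm_act_le[OF u b] norm_act_le[OF v b] u v b
      by (simp add: act_add distrib_right)
  qed (intro add_nonneg_nonneg norm_unitization_nonneg u v)
qed

lemma unitization_minus:
  assumes "a \<in> carrier A" "b \<in> carrier A"
  shows "(a, \<alpha>) \<ominus>\<^bsub>U\<^esub> (b, \<beta>) = (a \<ominus> b, \<alpha> - \<beta>)"
proof -
  interpret U: normed_cmodule U
    by (rule normed_cmodule_unitization)
  have "\<ominus>\<^bsub>U\<^esub> (b, \<beta>) = (\<ominus> b, - \<beta>)"
    using U.smult_simps(6)[of "(b, \<beta>)"] assms by simp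
  then show ?thesis
    using assms by (simp add: U.M.minus_eq M.minus_eq)
qed

text \<open>The coordinates of a Cauchy sequence are Cauchy by the two coordinate bounds; their
  limits give a limit in the unitization because the norm is at most the sum of the coordinate
  norms.\<close>

lemma mcomplete_unitization: "Metric_space.mcomplete (carrier U) (cdist U)"
proof -
  interpret U: normed_cmodule U
    by (rule normed_cmodule_unitization)
  show ?thesis
    unfolding U.mcomplete_iff
  proof (intro allI impI, elim conjE)
    fix \<sigma> :: "nat \<Rightarrow> 'a \<times> complex"
    assume \<sigma>: "\<forall>n. \<sigma> n \<in> carrier U"
      and C: "\<forall>\<epsilon>>0. \<exists>N. \<forall>m\<ge>N. \<forall>n\<ge>N. cnorm U (\<sigma> m \<ominus>\<^bsub>U\<^esub> \<sigma> n) < \<epsilon>"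
    have fst\<sigma>: "fst (\<sigma> n) \<in> carrier A" for n
      using \<sigma> by (metis mem_Times_iff unitization_simps(1))
    have diff: "fst (\<sigma> m) \<ominus> a = fst (\<sigma> m \<ominus>\<^bsub>U\<^esub> (a, \<alpha>))" "snd (\<sigma> m) - \<alpha> = snd (\<sigma> m \<ominus>\<^bsub>U\<^esub> (a, \<alpha>))"
      if "a \<in> carrier A" for m a \<alpha>
      using unitization_minus[OF fst\<sigma> that, of m "snd (\<sigma> m)" \<alpha>] by simp_all
    have mem: "\<sigma> m \<ominus>\<^bsub>U\<^esub> \<sigma> n \<in> carrier U" for m n
      using \<sigma> by blast
    have le: "cnorm A (fst (\<sigma> m) \<ominus> fst (\<sigma> n)) \<le> 2 * cnorm U (\<sigma> m \<ominus>\<^bsub>U\<^esub> \<sigma> n)"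
      "cmod (snd (\<sigma> m) - snd (\<sigma> n)) \<le> cnorm U (\<sigma> m \<ominus>\<^bsub>U\<^esub> \<sigma> n)" for m n
      using norm_vector_le[OF mem[of m n]] norm_scalar_le[OF mem[of m n]]
        diff[OF fst\<sigma>[of n], of m "snd (\<sigma> n)"] by simp_all
    have "Cauchy (\<lambda>n. snd (\<sigma> n))"
      unfolding Cauchy_def dist_norm using C le(2) by (meson le_less_trans)
    then obtain \<alpha> where \<alpha>: "(\<lambda>n. snd (\<sigma> n)) \<longlonglongrightarrow> \<alpha>"
      using Cauchy_convergent convergent_def by blast
    have "\<exists>N. \<forall>m\<ge>N. \<forall>n\<ge>N. cnorm A (fst (\<sigma> m) \<ominus> fst (\<sigma> n)) < \<epsilon>" if "\<epsilon> > 0" for \<epsilon>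
    proof -
      have "\<epsilon> / 2 > 0"
        using that by simp
      then obtain N where "\<forall>m\<ge>N. \<forall>n\<ge>N. cnorm U (\<sigma> m \<ominus>\<^bsub>U\<^esub> \<sigma> n) < \<epsilon> / 2"
        using C by blast
      then have "\<forall>m\<ge>N. \<forall>n\<ge>N. cnorm A (fst (\<sigma> m) \<ominus> fst (\<sigma> n)) < \<epsilon>"
        using le(1) by (smt (verit, best) field_sum_of_halves)
      then show ?thesis ..
    qed
    then obtain a where a: "a \<in> carrier A" "\<forall>\<epsilon>>0. \<exists>N. \<forall>n\<ge>N. cnorm A (fst (\<sigma> n) \<ominus> a) < \<epsilon>"
      using complete[unfolded mcomplete_iff, rule_format, of "\<lambda>n. fst (\<sigma> n)"] fst\<sigma> by auto
    have "\<exists>N. \<forall>n\<ge>N. cnorm U (\<sigma> n \<ominus>\<^bsub>U\<^esub> (a, \<alpha>)) < \<epsilon>" if "\<epsilon> > 0" for \<epsilon>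
    proof -
      have half: "\<epsilon> / 2 > 0"
        using that by simp
      obtain N where N: "\<forall>n\<ge>N. cnorm A (fst (\<sigma> n) \<ominus> a) < \<epsilon> / 2"
        using a(2) half by blast
      obtain N' where N': "\<forall>n\<ge>N'. cmod (snd (\<sigma> n) - \<alpha>) < \<epsilon> / 2"
        using \<alpha> half unfolding lim_sequentially dist_norm by blast
      have "cnorm U (\<sigma> n \<ominus>\<^bsub>U\<^esub> (a, \<alpha>)) < \<epsilon>" if n: "n \<ge> max N N'" for n
      proof -
        have "\<sigma> n \<ominus>\<^bsub>U\<^esub> (a, \<alpha>) \<in> carrier U"
          using \<sigma> a(1) by (intro U.M.minus_closed) auto
        then have "cnorm U (\<sigma> n \<ominus>\<^bsub>U\<^esub> (a, \<alpha>)) \<le> cnorm A (fst (\<sigma> n) \<ominus> a) + cmod (snd (\<sigma> n) - \<alpha>)"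
          unfolding diff[OF a(1), of n \<alpha>] diff(2)[OF a(1), of n \<alpha>] by (rule norm_unitization_le)
        moreover have "cnorm A (fst (\<sigma> n) \<ominus> a) < \<epsilon> / 2" "cmod (snd (\<sigma> n) - \<alpha>) < \<epsilon> / 2"
          using N N' n by auto
        ultimately show ?thesis
          by linarith
      qed
      then show ?thesis
        by blast
    qed
    then show "\<exists>u\<in>carrier U. \<forall>\<epsilon>>0. \<exists>N. \<forall>n\<ge>N. cnorm U (\<sigma> n \<ominus>\<^bsub>U\<^esub> u) < \<epsilon>"
      using a(1) by (intro bexI[of _ "(a, \<alpha>)"]) auto
  qed
qed

lemma cstar_algebra_unitization: "cstar_algebra U"
proof -
  interpret U: normed_cmodule U
    by (rule normed_cmodule_unitization)
  show ?thesis
    by (intro cstar_algebra.intro cstar_algebra_axioms.intro module_unitization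
        mcomplete_unitization norm_unitization_star norm_unitization_mult U.norm_nonneg
        U.norm_eq_zero U.norm_triangle U.norm_smult)
      (auto simp: mult_l_distr mult_r_distr smult_mult_left smult_mult_right smult_distr smult_add
        mult_assoc star_star star_add star_smult star_mult M.a_ac algebra_simps)
qed

end

section \<open>Generator rank of approximated algebras\<close>

text \<open>The additional elements are kept unperturbed. Since \<open>gr0\<close> is a least index,
  this is what makes \<open>gr0 A \<le> enat n\<close> equivalent to generation by
  \<open>n + 1\<close> elements.\<close>

lemma generically_generated_mono:
  assumes "cstar_algebra A" "generically_generated A k" "k \<le> n"
  shows "generically_generated A n"
  unfolding generically_generated_def
proof (intro allI impI, elim conjE)
  interpret cstar_algebra A by fact
  fix a :: "nat \<Rightarrow> 'a" and \<epsilon> :: real and c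
  assume a: "\<forall>j\<le>n. a j \<in> self_adjoint A" and \<epsilon>: "0 < \<epsilon>" and c: "c \<in> carrier A"
  obtain b where b: "\<forall>j\<le>k. b j \<in> self_adjoint A \<and> cnorm A (b j \<ominus>\<^bsub>A\<^esub> a j) < \<epsilon>"
    "within_of A c \<epsilon> (generated_cstar A (b ` {..k}))"
    using assms(2)[unfolded generically_generated_def, rule_format, of a \<epsilon> c] a \<epsilon> c \<open>k \<le> n\<close> by auto
  define b' where "b' j = (if j \<le> k then b j else a j)" for j
  have "b ` {..k} \<subseteq> b' ` {..n}"
    using \<open>k \<le> n\<close> by (force simp: b'_def)
  then have "within_of A c \<epsilon> (generated_cstar A (b' ` {..n}))"
    using b(2) generated_mono unfolding within_of_def by blast
  moreover have "\<forall>j\<le>n. b' j \<in> self_adjoint A \<and> cnorm A (b' j \<ominus>\<^bsub>A\<^esub> a j) < \<epsilon>"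
    using a b(1) \<epsilon> by (auto simp: b'_def self_adjoint_def M.minus_eq M.r_neg)
  ultimately show "\<exists>b. (\<forall>j\<le>n. b j \<in> self_adjoint A \<and> cnorm A (b j \<ominus>\<^bsub>A\<^esub> a j) < \<epsilon>) \<and>
      within_of A c \<epsilon> (generated_cstar A (b ` {..n}))"
    by blast
qed

lemma gr0_le_iff:
  assumes "cstar_algebra A"
  shows "gr0 A \<le> enat n \<longleftrightarrow> generically_generated A n"
proof
  assume "gr0 A \<le> enat n"
  then have ex: "\<exists>k. generically_generated A k" and "(LEAST k. generically_generated A k) \<le> n"
    by (auto simp: gr0_def split: if_splits)
  then show "generically_generated A n"
    using generically_generated_mono[OF assms LeastI_ex[OF ex]] by blast
next
  assume "generically_generated A n"
  then show "gr0 A \<le> enat n"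
    by (auto simp: gr0_def intro: Least_le)
qed

section \<open>Idealizers, real parts and units\<close>

context cstar_algebra
begin

text \<open>When \<open>A\<close> has a unit, the idealizer contains \<open>S\<close> together with
  that unit. It is thus a closed *-subalgebra in which elements of \<open>S\<close> may be shifted
  by scalars, even if \<open>S\<close> does not contain the unit.\<close>

lemma sub_cstar_idealizer:
  assumes S: "sub_cstar_algebra S A"
  shows "sub_cstar_algebra {x \<in> carrier A. \<forall>c\<in>S. x \<otimes> c \<in> S \<and> c \<otimes> x \<in> S} A"
proof -
  note SD = sub_cstarD[OF S]
  have left: "closedin (ctopology A) {x \<in> carrier A. x \<otimes> c \<in> S}" if c: "c \<in> carrier A" for c
  proof (rule closedin_vimage_Lipschitz[OF normed_cmodule_axioms normed_cmodule_axioms SD(8)])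
    fix x y assume "x \<in> carrier A" "y \<in> carrier A"
    then show "cnorm A (x \<otimes> c \<ominus> y \<otimes> c) \<le> cnorm A c * cnorm A (x \<ominus> y)"
      using norm_mult_minus_mult[of x c y c] c by (simp add: M.minus_eq M.r_neg mult.commute)
  qed (use c in simp)
  have right: "closedin (ctopology A) {x \<in> carrier A. c \<otimes> x \<in> S}" if c: "c \<in> carrier A" for c
  proof (rule closedin_vimage_Lipschitz[OF normed_cmodule_axioms normed_cmodule_axioms SD(8)])
    fix x y assume "x \<in> carrier A" "y \<in> carrier A"
    then show "cnorm A (c \<otimes> x \<ominus> c \<otimes> y) \<le> cnorm A c * cnorm A (x \<ominus> y)"
      using norm_mult_minus_mult[of c x c y] c by (simp add: M.minus_eq M.r_neg)
  qed (use c in simp)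
  \<comment> \<open>\<open>\<zero> \<in> S\<close> keeps the family nonempty; an empty intersection
    would be the whole type.\<close>
  have "{x \<in> carrier A. \<forall>c\<in>S. x \<otimes> c \<in> S \<and> c \<otimes> x \<in> S} =
      (\<Inter>c\<in>S. {x \<in> carrier A. x \<otimes> c \<in> S} \<inter> {x \<in> carrier A. c \<otimes> x \<in> S})"
    using SD(3) by auto
  then have "closedin (ctopology A) {x \<in> carrier A. \<forall>c\<in>S. x \<otimes> c \<in> S \<and> c \<otimes> x \<in> S}"
    using left right SD(2,3) by (auto intro!: closedin_INT closedin_Int)
  moreover have "star A x \<otimes> c \<in> S" "c \<otimes> star A x \<in> S"
    if "x \<in> carrier A" "\<forall>c\<in>S. x \<otimes> c \<in> S \<and> c \<otimes> x \<in> S" "c \<in> S" for x c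
  proof -
    have "star A x \<otimes> c = star A (star A c \<otimes> x)" "c \<otimes> star A x = star A (x \<otimes> star A c)"
      using that SD(2) by (simp_all add: star_mult star_star)
    then show "star A x \<otimes> c \<in> S" "c \<otimes> star A x \<in> S"
      using that SD(7) by simp_all
  qed
  moreover have "x \<otimes> y \<otimes> c \<in> S" "c \<otimes> (x \<otimes> y) \<in> S"
    if "x \<in> carrier A" "\<forall>c\<in>S. x \<otimes> c \<in> S \<and> c \<otimes> x \<in> S"
      "y \<in> carrier A" "\<forall>c\<in>S. y \<otimes> c \<in> S \<and> c \<otimes> y \<in> S" "c \<in> S" for x y c
    using that SD(2) mult_assoc[of x y c] mult_assoc[of c x y, symmetric] by auto
  ultimately show ?thesis
    using SD(2-5)
    by (auto simp: sub_cstar_algebra_def mult_l_distr mult_r_distr smult_mult_left smult_mult_right)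
qed

text \<open>Taking real parts does not increase norms and fixes \<open>a\<close>; arbitrary
  approximants of a self-adjoint element can so be made self-adjoint at no cost.\<close>

lemma norm_minus_real_part_le:
  assumes a: "a \<in> self_adjoint A" and u: "u \<in> carrier A"
  shows "cnorm A (a \<ominus> (1/2) \<odot> (u \<oplus> star A u)) \<le> cnorm A (a \<ominus> u)"
proof -
  have aA: "a \<in> carrier A" and sa: "star A a = a"
    using a by (auto simp: self_adjoint_def)
  have aa: "a = (1/2) \<odot> (a \<oplus> a)"
    using aA smult_add[of a "1/2" "1/2"] by (simp add: smult_distr)
  have "(a \<ominus> u) \<oplus> star A (a \<ominus> u) = (a \<oplus> a) \<ominus> (u \<oplus> star A u)"
    using aA u star_closed[OF u] unfolding star_minus[OF aA u] sa by algebra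
  then have "a \<ominus> (1/2) \<odot> (u \<oplus> star A u) = (1/2) \<odot> ((a \<ominus> u) \<oplus> star A (a \<ominus> u))"
    using aA u by (subst aa) (simp add: smult_diff)
  then show ?thesis
    using norm_triangle[of "a \<ominus> u" "star A (a \<ominus> u)"] aA u by (simp add: norm_smult)
qed

end

locale unital_cstar_algebra = cstar_algebra A for A :: "'a cstar" (structure) +
  fixes e
  assumes unit_closed [simp]: "e \<in> carrier A"
    and unit_mult [simp]: "a \<in> carrier A \<Longrightarrow> e \<otimes> a = a" "a \<in> carrier A \<Longrightarrow> a \<otimes> e = a"
begin

lemma star_unit [simp]: "star A e = e"
  using star_mult[of e "star A e"] by (simp add: star_star)

lemma unit_self_adjoint: "e \<in> self_adjoint A"
  by (simp add: self_adjoint_def)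

text \<open>Only an inequality, because the unit of the zero algebra is zero.\<close>

lemma norm_unit_le: "cnorm A e \<le> 1"
  using cstar_identity[of e] norm_nonneg[of e]
  by (cases "cnorm A e = 0") (auto simp: power2_eq_square)

end

context cstar_hom
begin

text \<open>Generators are pushed forward by \<open>h\<close>; the tolerance in \<open>D\<close> is
  halved to absorb the bound 2 on \<open>h\<close>.\<close>

lemma generically_generated_image:
  assumes gg: "generically_generated D n" and d: "\<forall>j\<le>n. d j \<in> self_adjoint D"
    and t: "t \<in> carrier D" and \<epsilon>: "\<epsilon> > 0"
  obtains b where "\<forall>j\<le>n. b j \<in> self_adjoint E \<and> cnorm E (b j \<ominus>\<^bsub>E\<^esub> h (d j)) < \<epsilon>"
    "within_of E (h t) \<epsilon> (generated_cstar E (b ` {..n}))"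
proof -
  obtain b where b: "\<forall>j\<le>n. b j \<in> self_adjoint D \<and> cnorm D (b j \<ominus>\<^bsub>D\<^esub> d j) < \<epsilon> / 2"
    and near: "within_of D t (\<epsilon> / 2) (generated_cstar D (b ` {..n}))"
    using gg[unfolded generically_generated_def, rule_format, of d "\<epsilon> / 2" t] d t \<epsilon> by auto
  have bD: "b j \<in> carrier D" "d j \<in> carrier D" if "j \<le> n" for j
    using b d that by (auto simp: self_adjoint_def)
  obtain g where g: "g \<in> generated_cstar D (b ` {..n})" "cnorm D (t \<ominus>\<^bsub>D\<^esub> g) < \<epsilon> / 2"
    using near by (auto simp: within_of_def)
  have sub: "b ` {..n} \<subseteq> carrier D"
    using bD by auto
  have gD: "g \<in> carrier D"
    using D.sub_cstarD(2)[OF D.sub_cstar_generated[OF sub] g(1)] .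
  have "h g \<in> generated_cstar E ((\<lambda>j. h (b j)) ` {..n})"
  proof (rule hom_generated[OF E.sub_cstar_generated sub _ g(1)])
    show "h ` b ` {..n} \<subseteq> generated_cstar E ((\<lambda>j. h (b j)) ` {..n})"
      using E.sub_generated[of "(\<lambda>j. h (b j)) ` {..n}"] by (simp add: image_image)
  qed (use bD in auto)
  moreover have "cnorm E (h t \<ominus>\<^bsub>E\<^esub> h g) < \<epsilon>"
    using norm_hom_minus_le[OF t gD] g(2) by simp
  ultimately have "within_of E (h t) \<epsilon> (generated_cstar E ((\<lambda>j. h (b j)) ` {..n}))"
    by (auto simp: within_of_def)
  moreover have "h (b j) \<in> self_adjoint E \<and> cnorm E (h (b j) \<ominus>\<^bsub>E\<^esub> h (d j)) < \<epsilon>" if "j \<le> n" for j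
    using norm_hom_minus_le[OF bD[OF that]] b that by (auto simp: hom_self_adjoint)
  ultimately show ?thesis
    using that[of "\<lambda>j. h (b j)"] by blast
qed

end

section \<open>Generating images of \<open>D\<close> together with scalars\<close>

locale unital_target = cstar_hom D E h + E: unital_cstar_algebra E e
  for D :: "'b cstar" and E :: "'a cstar" and h e
begin

text \<open>The unital extension of \<open>h\<close> to \<open>D + \<complex>1\<close>. It is a
  function of two arguments because it is also used for unital \<open>D\<close>, where
  \<open>unitization D\<close> with its norm is no C*-algebra.\<close>

definition ext :: "'b \<Rightarrow> complex \<Rightarrow> 'a" where
  "ext d \<alpha> = h d \<oplus>\<^bsub>E\<^esub> \<alpha> \<odot>\<^bsub>E\<^esub> e"

lemma ext_closed [simp]: "d \<in> carrier D \<Longrightarrow> ext d \<alpha> \<in> carrier E"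
  by (simp add: ext_def)

lemma ext_self_adjoint: "d \<in> self_adjoint D \<Longrightarrow> \<alpha> \<in> \<real> \<Longrightarrow> ext d \<alpha> \<in> self_adjoint E"
  unfolding ext_def
  by (intro E.self_adjoint_add hom_self_adjoint E.self_adjoint_smult E.unit_self_adjoint)

text \<open>The \<open>\<beta> j\<close> are nonzero and the \<open>b' j = b j - \<beta> j p\<close> generate \<open>p\<close>. Since \<open>h (b' j)\<close> differs
  from the generator \<open>h (b' j) + \<beta> j\<close> of \<open>C\<close> by a scalar, it lies in the idealizer of \<open>C\<close>, hence so does
  \<open>h p\<close>; multiplying by \<open>h p\<close> splits the generators into \<open>h (b j)\<close> and \<open>\<beta> j (1 - h p)\<close> inside \<open>C\<close>.\<close>

lemma generically_generated_ext_unital: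
  assumes "unital D" and gg: "generically_generated D n"
    and d: "\<forall>j\<le>n. d j \<in> self_adjoint D" and t: "t \<in> carrier D" and \<epsilon>: "\<epsilon> > 0"
  fixes \<alpha> :: "nat \<Rightarrow> real"
  obtains b where "\<forall>j\<le>n. b j \<in> self_adjoint E \<and> cnorm E (b j \<ominus>\<^bsub>E\<^esub> ext (d j) (\<alpha> j)) < \<epsilon>"
    "within_of E (ext t \<gamma>) \<epsilon> (generated_cstar E (b ` {..n}))"
proof -
  obtain p where "p \<in> carrier D" "\<forall>a\<in>carrier D. p \<otimes>\<^bsub>D\<^esub> a = a \<and> a \<otimes>\<^bsub>D\<^esub> p = a"
    using \<open>unital D\<close> unfolding unital_def by blast
  then interpret D: unital_cstar_algebra D p
    by unfold_locales auto
  \<comment> \<open>The error budget: the target is missed by less than \<open>4 * \<eta>\<close>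
    and each generator moves by less than \<open>5 * \<eta>\<close>, the bound 2 on \<open>h\<close>
    included.\<close>
  define \<eta> where "\<eta> = \<epsilon> / 8"
  have \<eta>: "\<eta> > 0"
    using \<epsilon> by (simp add: \<eta>_def)
  \<comment> \<open>A vanishing scalar is moved to \<open>\<eta> / 2\<close>, so that the later
    division by \<open>\<beta> 0\<close> is possible.\<close>
  define \<beta> where "\<beta> j = (if \<alpha> j = 0 then \<eta> / 2 else \<alpha> j)" for j
  have \<beta>: "\<beta> j \<noteq> 0" "\<bar>\<beta> j - \<alpha> j\<bar> < \<eta>" for j
    using \<eta> by (auto simp: \<beta>_def)
  \<comment> \<open>\<open>x j\<close> and \<open>s\<close> are the parts of the prescribed data
    under \<open>p\<close>: multiplying \<open>ext (d j) (\<beta> j)\<close> and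
    \<open>ext t \<gamma>\<close> by \<open>h p\<close> gives \<open>h (x j)\<close> and
    \<open>h s\<close>. The first perturbation is therefore made at the shifted tuple
    \<open>x\<close>.\<close>
  define x where "x j = d j \<oplus>\<^bsub>D\<^esub> complex_of_real (\<beta> j) \<odot>\<^bsub>D\<^esub> p" for j
  define s where "s = t \<oplus>\<^bsub>D\<^esub> \<gamma> \<odot>\<^bsub>D\<^esub> p"
  have dD: "d j \<in> carrier D" if "j \<le> n" for j
    using d that by (auto simp: self_adjoint_def)
  have "\<forall>j\<le>n. x j \<in> self_adjoint D"
    using d D.self_adjoint_add D.self_adjoint_smult[OF D.unit_self_adjoint] by (simp add: x_def)
  moreover have "s \<in> carrier D"
    using t by (simp add: s_def)
  ultimately obtain b1 where b1: "\<forall>j\<le>n. b1 j \<in> self_adjoint D \<and> cnorm D (b1 j \<ominus>\<^bsub>D\<^esub> x j) < \<eta>"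
    and "within_of D s \<eta> (generated_cstar D (b1 ` {..n}))"
    using gg[unfolded generically_generated_def, rule_format, of x \<eta> s] \<eta> by auto
  then obtain g where g: "g \<in> generated_cstar D (b1 ` {..n})" "cnorm D (s \<ominus>\<^bsub>D\<^esub> g) < \<eta>"
    by (auto simp: within_of_def)
  have b1D: "b1 j \<in> carrier D" if "j \<le> n" for j
    using b1 that by (auto simp: self_adjoint_def)
  \<comment> \<open>\<open>\<delta>\<close> is fixed after \<open>b1\<close>, so that the second
    perturbation can be taken small enough to keep \<open>g\<close>, and with it \<open>s\<close>,
    approximately generated.\<close>
  then obtain \<delta> where \<delta>: "\<delta> > 0" and stable:
    "\<And>b. (\<forall>j\<le>n. b j \<in> carrier D \<and> cnorm D (b j \<ominus>\<^bsub>D\<^esub> b1 j) < \<delta>)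
      \<Longrightarrow> within_of D g \<eta> (generated_cstar D (b ` {..n}))"
    using D.generated_stable[OF _ g(1) \<eta>] by blast
  define y where "y j = b1 j \<oplus>\<^bsub>D\<^esub> complex_of_real (- \<beta> j) \<odot>\<^bsub>D\<^esub> p" for j
  \<comment> \<open>Three demands on the second perturbation: \<open>\<delta>\<close> preserves the
    first approximation, \<open>\<eta>\<close> keeps the generators close, and 1 makes the generated
    algebra contain \<open>p\<close> exactly.\<close>
  define \<tau> where "\<tau> = min \<delta> (min \<eta> 1)"
  have \<tau>: "\<tau> > 0" "\<tau> \<le> \<delta>" "\<tau> \<le> \<eta>" "\<tau> \<le> 1"
    using \<delta> \<eta> by (auto simp: \<tau>_def)
  have "y j \<in> self_adjoint D" if "j \<le> n" for j
    unfolding y_def using b1 that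
    by (intro D.self_adjoint_add D.self_adjoint_smult[OF D.unit_self_adjoint]) auto
  then obtain b' where b': "\<forall>j\<le>n. b' j \<in> self_adjoint D \<and> cnorm D (b' j \<ominus>\<^bsub>D\<^esub> y j) < \<tau>"
    and near_p: "within_of D p \<tau> (generated_cstar D (b' ` {..n}))"
    using gg[unfolded generically_generated_def, rule_format, of y \<tau> p] \<tau> by auto
  have b'D: "b' j \<in> carrier D" if "j \<le> n" for j
    using b' that by (auto simp: self_adjoint_def)
  have b'sub: "b' ` {..n} \<subseteq> carrier D"
    using b'D by auto
  have p: "p \<in> generated_cstar D (b' ` {..n})"
  proof (rule D.unit_in_sub_cstar[OF D.sub_cstar_generated[OF b'sub]])
    show "within_of D p 1 (generated_cstar D (b' ` {..n}))"
      using near_p \<tau> unfolding within_of_def by force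
  qed auto
  define b where "b j = b' j \<oplus>\<^bsub>D\<^esub> complex_of_real (\<beta> j) \<odot>\<^bsub>D\<^esub> p" for j
  have bD: "b j \<in> carrier D" if "j \<le> n" for j
    using b'D[OF that] by (simp add: b_def)
  have bsub: "b ` {..n} \<subseteq> carrier D"
    using bD by auto
  have "cnorm D (b j \<ominus>\<^bsub>D\<^esub> b1 j) < \<delta>" if j: "j \<le> n" for j
  proof -
    let ?q = "complex_of_real (\<beta> j) \<odot>\<^bsub>D\<^esub> p"
    have "(b' j \<oplus>\<^bsub>D\<^esub> ?q) \<ominus>\<^bsub>D\<^esub> b1 j = b' j \<ominus>\<^bsub>D\<^esub> (b1 j \<oplus>\<^bsub>D\<^esub> \<ominus>\<^bsub>D\<^esub> ?q)"
      using b'D[OF j] b1D[OF j] D.smult_simps(1)[OF D.unit_closed, of "\<beta> j"] by algebra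
    then have "b j \<ominus>\<^bsub>D\<^esub> b1 j = b' j \<ominus>\<^bsub>D\<^esub> y j"
      by (simp add: b_def y_def D.smult_minus)
    then show ?thesis
      using b' j \<tau> by fastforce
  qed
  then obtain g' where g': "g' \<in> generated_cstar D (b ` {..n})" "cnorm D (g \<ominus>\<^bsub>D\<^esub> g') < \<eta>"
    using stable[of b] bD by (auto simp: within_of_def)
  have gD: "g \<in> carrier D"
    using D.sub_cstarD(2)[OF D.sub_cstar_generated g(1)] b1D by blast
  have g'D: "g' \<in> carrier D"
    using D.sub_cstarD(2)[OF D.sub_cstar_generated[OF bsub] g'(1)] .
  have sg': "cnorm D (s \<ominus>\<^bsub>D\<^esub> g') < 2 * \<eta>"
    using D.norm_triangle_minus[OF \<open>s \<in> carrier D\<close> gD g'D] g g' by simp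
  define B where "B j = ext (b' j) (\<beta> j)" for j
  define C where "C = generated_cstar E (B ` {..n})"
  have BE: "B j \<in> carrier E" if "j \<le> n" for j
    using b'D[OF that] by (simp add: B_def)
  have C: "sub_cstar_algebra C E"
    unfolding C_def using BE by (intro E.sub_cstar_generated) auto
  note CD = E.sub_cstarD[OF C]
  have BC: "B j \<in> C" if "j \<le> n" for j
    using E.sub_generated[of "B ` {..n}"] that by (auto simp: C_def)
  define M where "M = {x \<in> carrier E. \<forall>c\<in>C. x \<otimes>\<^bsub>E\<^esub> c \<in> C \<and> c \<otimes>\<^bsub>E\<^esub> x \<in> C}"
  have M: "sub_cstar_algebra M E"
    unfolding M_def by (rule E.sub_cstar_idealizer[OF C])
  have "h (b' j) \<in> M" if j: "j \<le> n" for j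
  proof -
    let ?q = "complex_of_real (\<beta> j) \<odot>\<^bsub>E\<^esub> e"
    have "h (b' j) = B j \<ominus>\<^bsub>E\<^esub> ?q"
      using hom_closed[OF b'D[OF j]] E.smult_simps(1)[OF E.unit_closed, of "\<beta> j"]
      unfolding B_def ext_def by algebra
    moreover have "B j \<in> M" "e \<in> M"
      using BC[OF j] CD(2,6) by (auto simp: M_def)
    ultimately show ?thesis
      using E.sub_cstar_minus[OF M] E.sub_cstarD(5)[OF M] by simp
  qed
  then have hp: "h p \<in> M"
    using hom_generated[OF M b'sub _ p] by blast
  have split: "h p \<otimes>\<^bsub>E\<^esub> B j = h (b j)" if j: "j \<le> n" for j
    using b'D[OF j]
    by (simp add: B_def ext_def b_def E.mult_r_distr E.smult_mult_right hom_mult[symmetric]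
        hom_add hom_smult)
  have hbC: "h (b j) \<in> C" if j: "j \<le> n" for j
    using hp BC[OF j] split[OF j] by (auto simp: M_def)
  then have hg'C: "h g' \<in> C"
    using hom_generated[OF C bsub _ g'(1)] by blast
  have eC: "e \<ominus>\<^bsub>E\<^esub> h p \<in> C"
  proof -
    \<comment> \<open>Index 0 is always in range. The difference \<open>B 0 - h (b 0)\<close> is
      \<open>\<beta> 0\<close> times \<open>e - h p\<close>.\<close>
    let ?q = "complex_of_real (\<beta> 0) \<odot>\<^bsub>E\<^esub> e" and ?r = "complex_of_real (\<beta> 0) \<odot>\<^bsub>E\<^esub> h p"
    have "B 0 \<ominus>\<^bsub>E\<^esub> h (b 0) = (h (b' 0) \<oplus>\<^bsub>E\<^esub> ?q) \<ominus>\<^bsub>E\<^esub> (h (b' 0) \<oplus>\<^bsub>E\<^esub> ?r)"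
      using b'D[of 0] by (simp add: B_def ext_def b_def hom_add hom_smult)
    also have "\<dots> = ?q \<ominus>\<^bsub>E\<^esub> ?r"
      using hom_closed[OF b'D[of 0]] E.smult_simps(1)[OF E.unit_closed, of "\<beta> 0"]
        E.smult_simps(1)[OF hom_closed[OF D.unit_closed], of "\<beta> 0"] by (simp, algebra)
    finally have "(1 / complex_of_real (\<beta> 0)) \<odot>\<^bsub>E\<^esub> (B 0 \<ominus>\<^bsub>E\<^esub> h (b 0)) = e \<ominus>\<^bsub>E\<^esub> h p"
      using \<beta>(1)[of 0] by (simp add: E.smult_diff)
    moreover have "B 0 \<ominus>\<^bsub>E\<^esub> h (b 0) \<in> C"
      using E.sub_cstar_minus[OF C BC hbC] by simp
    ultimately show ?thesis
      using CD(5) by metis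
  qed
  \<comment> \<open>Splitting \<open>e\<close> as \<open>h p + (e - h p)\<close> turns
    \<open>ext t \<gamma>\<close> into \<open>h s + \<gamma> (e - h p)\<close>. The second summand
    is met exactly by \<open>c\<close>, leaving the error \<open>h (s - g')\<close>.\<close>
  define c where "c = h g' \<oplus>\<^bsub>E\<^esub> \<gamma> \<odot>\<^bsub>E\<^esub> (e \<ominus>\<^bsub>E\<^esub> h p)"
  have "c \<in> C"
    using hg'C eC CD(4,5) by (simp add: c_def)
  moreover have "cnorm E (ext t \<gamma> \<ominus>\<^bsub>E\<^esub> c) < \<epsilon>"
  proof -
    have "ext t \<gamma> \<ominus>\<^bsub>E\<^esub> c = h t \<oplus>\<^bsub>E\<^esub> \<gamma> \<odot>\<^bsub>E\<^esub> h p \<ominus>\<^bsub>E\<^esub> h g'"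
      using hom_closed[OF t] hom_closed[OF g'D] E.smult_simps(1)[OF E.unit_closed, of \<gamma>]
        E.smult_simps(1)[OF hom_closed[OF D.unit_closed], of \<gamma>]
      unfolding ext_def c_def E.smult_diff[OF E.unit_closed hom_closed[OF D.unit_closed]]
      by algebra
    also have "\<dots> = h s \<ominus>\<^bsub>E\<^esub> h g'"
      using t by (simp add: s_def hom_add hom_smult)
    finally have "cnorm E (ext t \<gamma> \<ominus>\<^bsub>E\<^esub> c) \<le> 2 * cnorm D (s \<ominus>\<^bsub>D\<^esub> g')"
      using norm_hom_minus_le[OF \<open>s \<in> carrier D\<close> g'D] by simp
    then show ?thesis
      using sg' \<eta> by (simp add: \<eta>_def)
  qed
  ultimately have "within_of E (ext t \<gamma>) \<epsilon> (generated_cstar E (B ` {..n}))"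
    by (auto simp: within_of_def C_def)
  moreover have "B j \<in> self_adjoint E \<and> cnorm E (B j \<ominus>\<^bsub>E\<^esub> ext (d j) (\<alpha> j)) < \<epsilon>" if j: "j \<le> n" for j
  proof
    show "B j \<in> self_adjoint E"
      unfolding B_def using b' j by (intro ext_self_adjoint) auto
    let ?q = "complex_of_real (\<beta> j) \<odot>\<^bsub>D\<^esub> p"
    have yD: "y j \<in> carrier D"
      using b1D[OF j] by (simp add: y_def)
    have "b1 j \<oplus>\<^bsub>D\<^esub> \<ominus>\<^bsub>D\<^esub> ?q \<ominus>\<^bsub>D\<^esub> d j = b1 j \<ominus>\<^bsub>D\<^esub> (d j \<oplus>\<^bsub>D\<^esub> ?q)"
      using dD[OF j] b1D[OF j] D.smult_simps(1)[OF D.unit_closed, of "\<beta> j"] by algebra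
    then have "y j \<ominus>\<^bsub>D\<^esub> d j = b1 j \<ominus>\<^bsub>D\<^esub> x j"
      by (simp add: y_def x_def D.smult_minus)
    then have "cnorm D (b' j \<ominus>\<^bsub>D\<^esub> d j) < 2 * \<eta>"
      using D.norm_triangle_minus[OF b'D[OF j] yD dD[OF j]] b1 b' j \<tau> by fastforce
    then have "cnorm E (h (b' j) \<ominus>\<^bsub>E\<^esub> h (d j)) < 4 * \<eta>"
      using norm_hom_minus_le[OF b'D[OF j] dD[OF j]] by simp
    moreover have "cnorm E (complex_of_real (\<beta> j) \<odot>\<^bsub>E\<^esub> e \<ominus>\<^bsub>E\<^esub> complex_of_real (\<alpha> j) \<odot>\<^bsub>E\<^esub> e) \<le> \<eta>"
    proof -
      have "cmod (complex_of_real (\<beta> j) - complex_of_real (\<alpha> j)) = \<bar>\<beta> j - \<alpha> j\<bar>"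
        by (metis norm_of_real of_real_diff)
      then show ?thesis
        using \<beta>(2)[of j] E.norm_unit_le mult_mono[of "\<bar>\<beta> j - \<alpha> j\<bar>" \<eta> "cnorm E e" 1]
        by (simp add: E.norm_smult_minus_smult E.norm_nonneg)
    qed
    ultimately have "cnorm E (B j \<ominus>\<^bsub>E\<^esub> ext (d j) (\<alpha> j)) < 5 * \<eta>"
      using E.norm_add_minus_add[of "h (b' j)" "complex_of_real (\<beta> j) \<odot>\<^bsub>E\<^esub> e" "h (d j)"
          "complex_of_real (\<alpha> j) \<odot>\<^bsub>E\<^esub> e"] b'D[OF j] dD[OF j] unfolding B_def ext_def by simp
    then show "cnorm E (B j \<ominus>\<^bsub>E\<^esub> ext (d j) (\<alpha> j)) < \<epsilon>"
      using \<eta> by (simp add: \<eta>_def)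
  qed
  ultimately show ?thesis
    using that[of B] by blast
qed

lemma star_hom_unitization:
  assumes "\<not> unital D"
  shows "star_hom (\<lambda>(d, \<alpha>). ext d \<alpha>) (unitization D) E"
proof -
  interpret D: nonunital_cstar_algebra D
    by unfold_locales (rule assms)
  show ?thesis
    unfolding star_hom_def
    by (auto simp: ext_def hom_add hom_smult hom_mult hom_star E.smult_add E.smult_distr E.M.a_ac
        E.mult_l_distr E.mult_r_distr E.smult_mult_left E.smult_mult_right E.star_add E.star_smult
        mult.commute)
qed

text \<open>Here the case distinction in the definition of \<open>gr\<close> disappears: for
  nonunital \<open>D\<close> the unitization maps to \<open>E\<close> through \<open>ext\<close>,
  for unital \<open>D\<close> the scalars are generated alongside \<open>D\<close>.\<close>

lemma generically_generated_ext:
  assumes "gr D \<le> enat n"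
    and d: "\<forall>j\<le>n. d j \<in> self_adjoint D" and t: "t \<in> carrier D" and \<epsilon>: "\<epsilon> > 0"
  fixes \<alpha> :: "nat \<Rightarrow> real"
  obtains b where "\<forall>j\<le>n. b j \<in> self_adjoint E \<and> cnorm E (b j \<ominus>\<^bsub>E\<^esub> ext (d j) (\<alpha> j)) < \<epsilon>"
    "within_of E (ext t \<gamma>) \<epsilon> (generated_cstar E (b ` {..n}))"
proof (cases "unital D")
  case True
  then have "generically_generated D n"
    using assms(1) by (simp add: gr_def gr0_le_iff[OF D.cstar_algebra_axioms])
  from generically_generated_ext_unital[OF True this d t \<epsilon>] that show ?thesis
    by blast
next
  case False
  then interpret D: nonunital_cstar_algebra D
    by unfold_locales
  interpret U: cstar_hom "unitization D" E "\<lambda>(d, \<alpha>). ext d \<alpha>"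
    by (intro cstar_hom.intro cstar_hom_axioms.intro D.cstar_algebra_unitization
        E.cstar_algebra_axioms star_hom_unitization False)
  have "generically_generated (unitization D) n"
    using assms(1) False by (simp add: gr_def gr0_le_iff[OF D.cstar_algebra_unitization])
  moreover have "\<forall>j\<le>n. (d j, complex_of_real (\<alpha> j)) \<in> self_adjoint (unitization D)"
    using d by (simp add: self_adjoint_def)
  moreover have "(t, \<gamma>) \<in> carrier (unitization D)"
    using t by simp
  ultimately show ?thesis
    using U.generically_generated_image[of n "\<lambda>j. (d j, complex_of_real (\<alpha> j))" "(t, \<gamma>)" \<epsilon>] \<epsilon> that
    by auto
qed

text \<open>Lets an approximant of a self-adjoint element be replaced by one with self-adjoint
  \<open>D\<close>-part and real scalar, as the generation lemma requires.\<close>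

lemma ext_real_part:
  assumes "d \<in> carrier D"
  shows "ext ((1/2) \<odot>\<^bsub>D\<^esub> (d \<oplus>\<^bsub>D\<^esub> star D d)) (Re \<alpha>)
    = (1/2) \<odot>\<^bsub>E\<^esub> (ext d \<alpha> \<oplus>\<^bsub>E\<^esub> star E (ext d \<alpha>))"
proof -
  have "complex_of_real (Re \<alpha>) = 1/2 * \<alpha> + 1/2 * cnj \<alpha>"
    by (simp add: complex_eq_iff)
  then show ?thesis
    using assms by (simp add: ext_def hom_add hom_smult hom_star E.star_add E.star_smult
        E.smult_distr E.smult_add E.M.a_ac)
qed

end

text \<open>Approximants may carry a multiple of \<open>e\<close>, so that the same statement
  applies to a unital \<open>A\<close> and to the unitization of a nonunital one.\<close>

lemma generically_generated_if_approximated: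
  assumes E: "unital_cstar_algebra E e"
    and approx: "\<And>F \<epsilon>. \<lbrakk>finite F; F \<subseteq> carrier E; \<epsilon> > 0\<rbrakk> \<Longrightarrow>
      \<exists>(D :: 'b cstar) h. cstar_hom D E h \<and> gr D \<le> enat n \<and>
        (\<forall>a\<in>F. \<exists>d\<in>carrier D. \<exists>\<alpha>. cnorm E (a \<ominus>\<^bsub>E\<^esub> (h d \<oplus>\<^bsub>E\<^esub> \<alpha> \<odot>\<^bsub>E\<^esub> e)) < \<epsilon>)"
  shows "generically_generated E n"
  unfolding generically_generated_def
proof (intro allI impI, elim conjE)
  interpret E: unital_cstar_algebra E e by (rule E)
  fix a and \<epsilon> :: real and c
  assume a: "\<forall>j\<le>n. a j \<in> self_adjoint E" and \<epsilon>: "0 < \<epsilon>" and c: "c \<in> carrier E"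
  have aE: "a j \<in> carrier E" if "j \<le> n" for j
    using a that by (simp add: self_adjoint_def)
  \<comment> \<open>The tuple and \<open>c\<close> are approximated together, so one
    \<open>D\<close> serves all of them. Half of \<open>\<epsilon>\<close> is spent here and half on
    generation.\<close>
  have "finite (insert c (a ` {..n}))" "insert c (a ` {..n}) \<subseteq> carrier E" "\<epsilon> / 2 > 0"
    using aE c \<epsilon> by auto
  from approx[OF this] obtain D :: "'b cstar" and h where hom: "cstar_hom D E h" and gr: "gr D \<le> enat n"
    and near: "\<forall>x\<in>insert c (a ` {..n}). \<exists>d\<in>carrier D. \<exists>\<alpha>.
      cnorm E (x \<ominus>\<^bsub>E\<^esub> (h d \<oplus>\<^bsub>E\<^esub> \<alpha> \<odot>\<^bsub>E\<^esub> e)) < \<epsilon> / 2"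
    by blast
  interpret unital_target D E h e
    by (intro unital_target.intro hom E)
  obtain t \<gamma> where t: "t \<in> carrier D" "cnorm E (c \<ominus>\<^bsub>E\<^esub> ext t \<gamma>) < \<epsilon> / 2"
    using near by (auto simp: ext_def)
  have "\<exists>d \<alpha>. d \<in> carrier D \<and> cnorm E (a j \<ominus>\<^bsub>E\<^esub> ext d \<alpha>) < \<epsilon> / 2" if "j \<le> n" for j
    using near that unfolding ext_def by blast
  then obtain d \<alpha> where d: "\<And>j. j \<le> n \<Longrightarrow> d j \<in> carrier D"
    "\<And>j. j \<le> n \<Longrightarrow> cnorm E (a j \<ominus>\<^bsub>E\<^esub> ext (d j) (\<alpha> j)) < \<epsilon> / 2"
    by metis
  define d' where "d' j = (1/2) \<odot>\<^bsub>D\<^esub> (d j \<oplus>\<^bsub>D\<^esub> star D (d j))" for j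
  have d'_closed: "d' j \<in> carrier D" if "j \<le> n" for j
    using d(1)[OF that] by (simp add: d'_def)
  have d': "cnorm E (a j \<ominus>\<^bsub>E\<^esub> ext (d' j) (Re (\<alpha> j))) < \<epsilon> / 2" if j: "j \<le> n" for j
    using E.norm_minus_real_part_le[of "a j" "ext (d j) (\<alpha> j)"] a d j
    by (fastforce simp: d'_def ext_real_part)
  have "\<forall>j\<le>n. d' j \<in> self_adjoint D"
    using d(1) by (auto simp: d'_def self_adjoint_def D.star_smult D.star_add D.star_star D.M.a_comm)
  then obtain b where b: "\<forall>j\<le>n. b j \<in> self_adjoint E \<and> cnorm E (b j \<ominus>\<^bsub>E\<^esub> ext (d' j) (Re (\<alpha> j))) < \<epsilon> / 2"
    and near_t: "within_of E (ext t \<gamma>) (\<epsilon> / 2) (generated_cstar E (b ` {..n}))"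
    using generically_generated_ext[OF gr _ t(1), of d' "\<epsilon> / 2" "\<lambda>j. Re (\<alpha> j)" \<gamma>] \<epsilon> by auto
  have bE: "b j \<in> carrier E" if "j \<le> n" for j
    using b that by (simp add: self_adjoint_def)
  have "cnorm E (b j \<ominus>\<^bsub>E\<^esub> a j) < \<epsilon>" if j: "j \<le> n" for j
    using E.norm_triangle_minus[OF bE[OF j] ext_closed[OF d'_closed[OF j]] aE[OF j], of "Re (\<alpha> j)"]
      E.norm_minus_commute[OF ext_closed[OF d'_closed[OF j]] aE[OF j], of "Re (\<alpha> j)"] b d'[OF j] j
    by fastforce
  moreover have "within_of E c (\<epsilon> / 2 + \<epsilon> / 2) (generated_cstar E (b ` {..n}))"
  proof (rule E.within_of_triangle[OF near_t])
    have "b ` {..n} \<subseteq> carrier E"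
      using bE by auto
    then show "generated_cstar E (b ` {..n}) \<subseteq> carrier E"
      by (rule E.sub_cstarD(1)[OF E.sub_cstar_generated])
  qed (use t c in auto)
  ultimately show "\<exists>b. (\<forall>j\<le>n. b j \<in> self_adjoint E \<and> cnorm E (b j \<ominus>\<^bsub>E\<^esub> a j) < \<epsilon>) \<and>
      within_of E c \<epsilon> (generated_cstar E (b ` {..n}))"
    using b by auto
qed

text \<open>The carrier type of \<open>D\<close> is independent of that of \<open>A\<close> and
  \<open>h\<close> may have a kernel; inclusions of subalgebras and canonical maps into an inductive
  limit are thereby both covered.\<close>

lemma gr_le_if_approximated:
  assumes A: "cstar_algebra (A :: 'a cstar)"
    and approx: "\<And>F \<epsilon>. \<lbrakk>finite F; F \<subseteq> carrier A; \<epsilon> > 0\<rbrakk> \<Longrightarrow>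
      \<exists>(D :: 'b cstar) h. cstar_algebra D \<and> star_hom h D A \<and> gr D \<le> enat n \<and>
        (\<forall>a\<in>F. within_of A a \<epsilon> (h ` carrier D))"
  shows "gr A \<le> enat n"
proof -
  interpret A: cstar_algebra A by (rule A)
  show ?thesis
  proof (cases "unital A")
    case True
    then obtain e where "e \<in> carrier A" "\<forall>a\<in>carrier A. e \<otimes>\<^bsub>A\<^esub> a = a \<and> a \<otimes>\<^bsub>A\<^esub> e = a"
      unfolding unital_def by blast
    then interpret A: unital_cstar_algebra A e
      by unfold_locales auto
    have "generically_generated A n"
    proof (rule generically_generated_if_approximated[OF A.unital_cstar_algebra_axioms])
      fix F and \<epsilon> :: real assume "finite F" "F \<subseteq> carrier A" "\<epsilon> > 0"
      from approx[OF this] obtain D :: "'b cstar" and h where D: "cstar_algebra D" "star_hom h D A"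
        "gr D \<le> enat n" "\<forall>a\<in>F. within_of A a \<epsilon> (h ` carrier D)"
        by blast
      interpret cstar_hom D A h
        by (intro cstar_hom.intro cstar_hom_axioms.intro D A)
      have "\<exists>d\<in>carrier D. \<exists>\<alpha>. cnorm A (a \<ominus>\<^bsub>A\<^esub> (h d \<oplus>\<^bsub>A\<^esub> \<alpha> \<odot>\<^bsub>A\<^esub> e)) < \<epsilon>" if a: "a \<in> F" for a
      proof -
        obtain d where "d \<in> carrier D" "cnorm A (a \<ominus>\<^bsub>A\<^esub> h d) < \<epsilon>"
          using D(4) a by (auto simp: within_of_def)
        then show ?thesis
          by (intro bexI[of _ d] exI[of _ 0]) auto
      qed
      then show "\<exists>(D :: 'b cstar) h. cstar_hom D A h \<and> gr D \<le> enat n \<and>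
        (\<forall>a\<in>F. \<exists>d\<in>carrier D. \<exists>\<alpha>. cnorm A (a \<ominus>\<^bsub>A\<^esub> (h d \<oplus>\<^bsub>A\<^esub> \<alpha> \<odot>\<^bsub>A\<^esub> e)) < \<epsilon>)"
        using cstar_hom_axioms D(3) by blast
    qed
    then show ?thesis
      using True by (simp add: gr_def gr0_le_iff[OF A])
  next
    case False
    interpret A: nonunital_cstar_algebra A
      by unfold_locales (rule False)
    interpret U: cstar_algebra "unitization A"
      by (rule A.cstar_algebra_unitization)
    have U: "unital_cstar_algebra (unitization A) (\<zero>\<^bsub>A\<^esub>, 1)"
      by unfold_locales auto
    have "generically_generated (unitization A) n"
    proof (rule generically_generated_if_approximated[OF U])
      fix F and \<epsilon> :: real assume F: "finite F" "F \<subseteq> carrier (unitization A)" "\<epsilon> > 0"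
      \<comment> \<open>Only vector parts are approximated; choosing \<open>\<beta>\<close> as the
        scalar part of \<open>u\<close> makes the scalars cancel.\<close>
      have "finite (fst ` F)" "fst ` F \<subseteq> carrier A"
        using F by auto
      from approx[OF this F(3)] obtain D :: "'b cstar" and h where D: "cstar_algebra D" "star_hom h D A"
        "gr D \<le> enat n" "\<forall>a\<in>fst ` F. within_of A a \<epsilon> (h ` carrier D)"
        by blast
      interpret cstar_hom D A h
        by (intro cstar_hom.intro cstar_hom_axioms.intro D A)
      have "star_hom (\<lambda>d. (h d, 0)) D (unitization A)"
        unfolding star_hom_def by (auto simp: hom_add hom_smult hom_mult hom_star)
      then have hom: "cstar_hom D (unitization A) (\<lambda>d. (h d, 0))"
        by (intro cstar_hom.intro cstar_hom_axioms.intro D U.cstar_algebra_axioms)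
      have "\<exists>d\<in>carrier D. \<exists>\<beta>. cnorm (unitization A)
          (u \<ominus>\<^bsub>unitization A\<^esub> ((h d, 0) \<oplus>\<^bsub>unitization A\<^esub> \<beta> \<odot>\<^bsub>unitization A\<^esub> (\<zero>\<^bsub>A\<^esub>, 1))) < \<epsilon>"
        if u: "u \<in> F" for u
      proof -
        obtain a \<alpha> where au: "u = (a, \<alpha>)"
          by (cases u)
        have a: "a \<in> carrier A"
          using F(2) u au by auto
        obtain d where d: "d \<in> carrier D" "cnorm A (a \<ominus>\<^bsub>A\<^esub> h d) < \<epsilon>"
          using D(4) u au by (fastforce simp: within_of_def)
        have "cnorm (unitization A) (a \<ominus>\<^bsub>A\<^esub> h d, 0) < \<epsilon>"
          using A.norm_unitization_le[of "(a \<ominus>\<^bsub>A\<^esub> h d, 0)"] a d by simp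
        then show ?thesis
          using a d au by (intro bexI[of _ d] exI[of _ \<alpha>]) (auto simp: A.unitization_minus)
      qed
      then show "\<exists>(D :: 'b cstar) h. cstar_hom D (unitization A) h \<and> gr D \<le> enat n \<and>
        (\<forall>u\<in>F. \<exists>d\<in>carrier D. \<exists>\<beta>. cnorm (unitization A)
          (u \<ominus>\<^bsub>unitization A\<^esub> (h d \<oplus>\<^bsub>unitization A\<^esub> \<beta> \<odot>\<^bsub>unitization A\<^esub> (\<zero>\<^bsub>A\<^esub>, 1))) < \<epsilon>)"
        using hom D(3) by blast
    qed
    then show ?thesis
      using False by (simp add: gr_def gr0_le_iff[OF U.cstar_algebra_axioms])
  qed
qed

section \<open>Application to approximating subalgebras and inductive limits\<close>

lemma gr_le_if_approximated_by:
  fixes A :: "'a cstar"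
  assumes A: "cstar_algebra A" and "approximated_by A \<Lambda> B"
    and gr: "\<forall>l\<in>\<Lambda>. gr (subalg A (B l)) \<le> enat n"
  shows "gr A \<le> enat n"
proof (rule gr_le_if_approximated[where ?'b = 'a, OF A])
  interpret cstar_algebra A by (rule A)
  fix F and \<epsilon> :: real assume "finite F" "F \<subseteq> carrier A" "\<epsilon> > 0"
  then obtain l where l: "l \<in> \<Lambda>" "sub_cstar_algebra (B l) A" "\<forall>a\<in>F. within_of A a \<epsilon> (B l)"
    using assms(2) unfolding approximated_by_def by blast
  have "star_hom (\<lambda>x. x) (subalg A (B l)) A"
    using sub_cstarD(2)[OF l(2)] by (auto simp: star_hom_def)
  then show "\<exists>(D :: 'a cstar) h. cstar_algebra D \<and> star_hom h D A \<and> gr D \<le> enat n \<and>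
      (\<forall>a\<in>F. within_of A a \<epsilon> (h ` carrier D))"
    using cstar_algebra_subalg[OF l(2)] gr l
    by (intro exI[of _ "subalg A (B l)"] exI[of _ "\<lambda>x. x"]) auto
qed

lemma directed_upper_bound:
  assumes dir: "directed_set J r" and "finite I" "I \<subseteq> J"
  obtains k where "k \<in> J" "\<forall>i\<in>I. (i, k) \<in> r"
proof -
  have "\<exists>k\<in>J. \<forall>i\<in>I. (i, k) \<in> r"
    using assms(2,3)
  proof (induction I rule: finite_induct)
    case empty
    then show ?case
      using dir by (auto simp: directed_set_def)
  next
    case (insert i I)
    then obtain k where k: "k \<in> J" "\<forall>i\<in>I. (i, k) \<in> r"
      by blast
    obtain m where m: "m \<in> J" "(i, m) \<in> r" "(k, m) \<in> r"
      using dir insert.prems k(1) unfolding directed_set_def by blast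
    have "(i', m) \<in> r" if "i' \<in> I" for i'
      using dir k(2) m(3) that unfolding directed_set_def preorder_on_def by (meson transD)
    then show ?case
      using m by blast
  qed
  then show ?thesis
    using that by blast
qed

text \<open>A nonempty infimum in \<open>enat\<close> is attained, and the empty one is
  \<open>\<infinity>\<close>. A finite bound on the infimum over the tail beyond \<open>j\<close> is
  therefore realized by an actual index in that tail.\<close>

lemma Liminf_le_imp_frequently:
  fixes f :: "'i \<Rightarrow> enat"
  assumes "Liminf (directed_filter J r) f \<le> enat n" "j \<in> J"
  obtains k where "k \<in> J" "(j, k) \<in> r" "f k \<le> enat n"
proof -
  let ?P = "\<lambda>k. k \<in> J \<and> (j, k) \<in> r"
  have "eventually ?P (directed_filter J r)"
    unfolding directed_filter_def using assms(2)
    by (intro eventually_INF1[of j]) (simp_all add: eventually_principal)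
  then have "Inf (f ` Collect ?P) \<le> Liminf (directed_filter J r) f"
    unfolding Liminf_def by (intro SUP_upper) simp
  then have le: "Inf (f ` Collect ?P) \<le> enat n"
    using assms(1) by (rule order_trans)
  have "f ` Collect ?P \<noteq> {}"
  proof
    assume "f ` Collect ?P = {}"
    then have "Inf (f ` Collect ?P) = \<infinity>"
      by (simp add: Inf_enat_def)
    with le show False
      by simp
  qed
  then have "Inf (f ` Collect ?P) \<in> f ` Collect ?P"
    unfolding Inf_enat_def by (auto intro: LeastI)
  then show ?thesis
    using le that by auto
qed

text \<open>Finitely many approximants coming from different stages can be moved to one later stage
  of small rank, since the connecting maps do not change their images in \<open>A\<close>. An
  infinite limit inferior bounds nothing, which leaves the finite case.\<close>

lemma gr_inductive_limit_le:
  fixes A :: "'a cstar" and As :: "'i \<Rightarrow> 'b cstar"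
  assumes lim: "inductive_limit J r As \<phi> A \<psi>"
  shows "gr A \<le> Liminf (directed_filter J r) (\<lambda>j. gr (As j))"
proof (cases "Liminf (directed_filter J r) (\<lambda>j. gr (As j))")
  case (enat n)
  have A: "cstar_algebra A" and dir: "directed_set J r"
    and As: "\<And>j. j \<in> J \<Longrightarrow> cstar_algebra (As j)"
    and \<phi>: "\<And>i j. (i, j) \<in> r \<Longrightarrow> star_hom (\<phi> i j) (As i) (As j)"
    and \<psi>: "\<And>j. j \<in> J \<Longrightarrow> star_hom (\<psi> j) (As j) A"
    and compat: "\<And>i j x. (i, j) \<in> r \<Longrightarrow> x \<in> carrier (As i) \<Longrightarrow> \<psi> j (\<phi> i j x) = \<psi> i x"
    and dense: "ctopology A closure_of (\<Union>j\<in>J. \<psi> j ` carrier (As j)) = carrier A"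
    using lim unfolding inductive_limit_def inductive_system_def by auto
  interpret cstar_algebra A by (rule A)
  have sub: "(\<Union>j\<in>J. \<psi> j ` carrier (As j)) \<subseteq> carrier A"
    using \<psi> by (auto simp: star_hom_def)
  have "gr A \<le> enat n"
  proof (rule gr_le_if_approximated[where ?'b = 'b, OF A])
    fix F and \<epsilon> :: real assume F: "finite F" "F \<subseteq> carrier A" and \<epsilon>: "\<epsilon> > 0"
    have "\<exists>j x. j \<in> J \<and> x \<in> carrier (As j) \<and> cnorm A (a \<ominus>\<^bsub>A\<^esub> \<psi> j x) < \<epsilon>" if "a \<in> F" for a
      using in_closure_iff[OF sub, of a] F(2) that \<epsilon> unfolding dense within_of_def by blast
    then obtain j x where j: "\<And>a. a \<in> F \<Longrightarrow> j a \<in> J" and x: "\<And>a. a \<in> F \<Longrightarrow> x a \<in> carrier (As (j a))"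
      and near: "\<And>a. a \<in> F \<Longrightarrow> cnorm A (a \<ominus>\<^bsub>A\<^esub> \<psi> (j a) (x a)) < \<epsilon>"
      by metis
    \<comment> \<open>\<open>i\<close> lies above the stages of all approximants; \<open>k\<close>
      is then chosen above \<open>i\<close>, because the limit inferior promises small rank only at
      some index beyond a given one.\<close>
    obtain i where i: "i \<in> J" "\<forall>a\<in>F. (j a, i) \<in> r"
      using directed_upper_bound[OF dir, of "j ` F"] F(1) j by auto
    obtain k where k: "k \<in> J" "(i, k) \<in> r" "gr (As k) \<le> enat n"
      using Liminf_le_imp_frequently[OF eq_refl[OF enat] i(1)] .
    have "within_of A a \<epsilon> (\<psi> k ` carrier (As k))" if a: "a \<in> F" for a
    proof -
      have r: "(j a, k) \<in> r"
        using dir i(2) k(2) a unfolding directed_set_def preorder_on_def by (meson transD)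
      then have "\<phi> (j a) k (x a) \<in> carrier (As k)" "\<psi> k (\<phi> (j a) k (x a)) = \<psi> (j a) (x a)"
        using \<phi>[OF r] compat[OF r x[OF a]] x[OF a] by (auto simp: star_hom_def)
      then show ?thesis
        using near[OF a] unfolding within_of_def by (metis imageI)
    qed
    then show "\<exists>(D :: 'b cstar) h. cstar_algebra D \<and> star_hom h D A \<and> gr D \<le> enat n \<and>
        (\<forall>a\<in>F. within_of A a \<epsilon> (h ` carrier D))"
      using As[OF k(1)] \<psi>[OF k(1)] k(3) by blast
  qed
  then show ?thesis
    using enat by simp
qed simp

theorem theorem6p3:
  fixes A :: "'a cstar" and n :: nat
    and \<Lambda> :: "'l set" and B :: "'l \<Rightarrow> 'a set"
    and J :: "'i set" and r :: "('i \<times> 'i) set" and As :: "'i \<Rightarrow> 'b cstar"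
    and \<phi> :: "'i \<Rightarrow> 'i \<Rightarrow> 'b \<Rightarrow> 'b" and \<psi> :: "'i \<Rightarrow> 'b \<Rightarrow> 'a"
  assumes "cstar_algebra A"
  shows "(approximated_by A \<Lambda> B \<and> (\<forall>l\<in>\<Lambda>. gr (subalg A (B l)) \<le> enat n) \<longrightarrow> gr A \<le> enat n) \<and>
         (inductive_limit J r As \<phi> A \<psi> \<longrightarrow>
            gr A \<le> Liminf (directed_filter J r) (\<lambda>j. gr (As j)))"
  using gr_le_if_approximated_by[OF assms] gr_inductive_limit_le by blast

end
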